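(* Let $K$ and $K^\circ$ be Alexander duals of each other relative to $[m]$. For any $(\sigma,\omega)\in\mathcal X_m$ with $\omega\ne\emptyset$, put $\sigma'=[m]\setminus(\sigma\cup\omega)$. Then $$(K_{\sigma,\omega})^\circ=(K^\circ)_{\sigma',\omega},$$ where $(K_{\sigma,\omega})^\circ$ is the dual of $K_{\sigma,\omega}$ relative to $\omega$. Moreover there are local (co)homology group duality isomorphisms $$\gamma_{K,\sigma,\omega}\colon H_*^{\sigma,\omega}(K)\to H^{|\omega|-*-1}_{\sigma',\omega}(K^\circ),\qquad\gamma^\circ_{K,\sigma,\omega}\colon H^*_{\sigma,\omega}(K)\to H_{|\omega|-*-1}^{\sigma',\omega}(K^\circ)$$ such that $\gamma^\circ_{K,\sigma,\omega}=\gamma_{K^\circ,\sigma',\omega}^{-1}$.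
   Context: $[m]=\{1,\dots,m\}$. A simplicial complex $K$ on a finite set $S$ is a set of subsets of $S$ closed under taking subsets; ghost vertices, the void complex $\{\,\}$ (no simplices) and $\{\emptyset\}$ are allowed. For $S\neq\emptyset$ the Alexander dual of $K$ relative to $S$ is $K^\circ=\{S\setminus\tau:\tau\subset S,\tau\notin K\}$. $\mathcal X_m=\{(\sigma,\omega):\sigma,\omega\subset[m],\sigma\cap\omega=\emptyset\}$. For $(\sigma,\omega)\in\mathcal X_m$ the local complex is $K_{\sigma,\omega}=\{\tau\subset\omega:\tau\cup\sigma\in K\}$ if $\sigma\in K$ and $K_{\sigma,\omega}=\{\,\}$ if $\sigma\notin K$. The local (co)homology groups are defined as follows. Let $T_*$ be free on $\mathrm e,\mathrm n,\mathrm i$ (degree $0$), $\bar{\mathrm n}$ (degree $1$), $d\bar{\mathrm n}=\mathrm n$, and $S_*=\mathbb Z(\mathrm n,\mathrm i)$; $\mathrm n,\bar{\mathrm n}$ have index $\mathrm n$, $\mathrm e$ has index $\mathrm e$, $\mathrm i$ has index $\mathrm i$. Let $T_*(K)=\sum_{\tau\in K}U_1\otimes\cdots\otimes U_m\subset T_*^{\otimes m}$, $U_k=T_*$ if $k\in\tau$, $S_*$ otherwise. $H_*^{\sigma,\omega}(K)$ is the homology of the summand of $T_*(K)$ spanned by basis tensors with index $\mathrm e$ exactly on $\sigma$ and index $\mathrm n$ exactly on $\omega$, and $H^*_{\sigma,\omega}(K)$ is the homology of its dual. These are identified with $\widetilde H_{*-1}(K_{\sigma,\omega})$ and $\widetilde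 H^{*-1}(K_{\sigma,\omega})$ (augmented simplicial (co)homology, $\emptyset$ in degree $-1$, zero for the void complex). *)

theory Defs
  imports "HOL-Algebra.Algebra"
begin

definition simplicial_complex_on :: "nat set \<Rightarrow> nat set set \<Rightarrow> bool" where
  "simplicial_complex_on S K \<longleftrightarrow>
     finite S \<and> K \<subseteq> Pow S \<and> (\<forall>\<tau>\<in>K. \<forall>\<tau>'. \<tau>' \<subseteq> \<tau> \<longrightarrow> \<tau>' \<in> K)"

definition alexander_dual :: "nat set \<Rightarrow> nat set set \<Rightarrow> nat set set" where
  "alexander_dual S K = {S - \<tau> |\<tau>. \<tau> \<subseteq> S \<and> \<tau> \<notin> K}"

definition index_pairs :: "nat \<Rightarrow> (nat set \<times> nat set) set" where
  "index_pairs m = {(\<sigma>, \<omega>). \<sigma> \<subseteq> {1..m} \<and> \<omega> \<subseteq> {1..m} \<and> \<sigma> \<inter> \<omega> = {}}"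

definition local_complex :: "nat set set \<Rightarrow> nat set \<Rightarrow> nat set \<Rightarrow> nat set set" where
  "local_complex K \<sigma> \<omega> = (if \<sigma> \<in> K then {\<tau>. \<tau> \<subseteq> \<omega> \<and> \<tau> \<union> \<sigma> \<in> K} else {})"

text \<open>
  The basis elements e, n, i and n-bar of \<open>T\<^sub>*\<close>, in this order.
\<close>
datatype gen = GE | GN | GI | GNbar

datatype gen_index = IE | IN | II

fun gen_deg :: "gen \<Rightarrow> nat" where
  "gen_deg GNbar = 1"
| "gen_deg _ = 0"

fun gen_idx :: "gen \<Rightarrow> gen_index" where
  "gen_idx GE = IE"
| "gen_idx GN = IN"
| "gen_idx GNbar = IN"
| "gen_idx GI = II"

fun gen_diff :: "gen \<Rightarrow> (gen \<Rightarrow>\<^sub>0 int)" where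
  "gen_diff GNbar = frag_of GN"
| "gen_diff _ = 0"

definition T_basis :: "gen set" where "T_basis = {GE, GN, GI, GNbar}"

definition S_basis :: "gen set" where "S_basis = {GN, GI}"

text \<open>
  The basis tensor \<open>w 1 \<otimes> \<dots> \<otimes> w m\<close> of the \<open>m\<close>-fold tensor power of \<open>T\<^sub>*\<close> is encoded by the
  extensional function \<open>w\<close> on \<open>{1..m}\<close>. All groups of chains are free abelian groups on sets of
  such basis tensors; in particular the sum of the groups \<open>U\<^sub>1 \<otimes> \<dots> \<otimes> U\<^sub>m\<close> over the simplices
  of \<open>K\<close> is the free abelian group on the union of their bases.
\<close>
type_synonym tensor = "nat \<Rightarrow> gen"

definition T_complex_basis :: "nat \<Rightarrow> nat set set \<Rightarrow> tensor set" where
  "T_complex_basis m K =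
     (\<Union>\<tau>\<in>K. \<Pi>\<^sub>E k\<in>{1..m}. if k \<in> \<tau> then T_basis else S_basis)"

definition tensor_deg :: "nat \<Rightarrow> tensor \<Rightarrow> nat" where
  "tensor_deg m w = (\<Sum>k\<in>{1..m}. gen_deg (w k))"

text \<open>
  The differential of the tensor power, with the Koszul sign rule
  \<open>d(x \<otimes> y) = d x \<otimes> y + (-1)^deg x \<cdot> x \<otimes> d y\<close>.
\<close>
definition tensor_diff_basis :: "nat \<Rightarrow> tensor \<Rightarrow> (tensor \<Rightarrow>\<^sub>0 int)" where
  "tensor_diff_basis m w =
     (\<Sum>k\<in>{1..m}. frag_cmul ((-1) ^ (\<Sum>j\<in>{1..<k}. gen_deg (w j)))
        (frag_extend (\<lambda>x. frag_of (w(k := x))) (gen_diff (w k))))"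

definition tensor_diff :: "nat \<Rightarrow> (tensor \<Rightarrow>\<^sub>0 int) \<Rightarrow> (tensor \<Rightarrow>\<^sub>0 int)" where
  "tensor_diff m = frag_extend (tensor_diff_basis m)"

definition local_basis ::
    "nat \<Rightarrow> nat set set \<Rightarrow> nat set \<Rightarrow> nat set \<Rightarrow> tensor set" where
  "local_basis m K \<sigma> \<omega> = {w \<in> T_complex_basis m K.
     {k \<in> {1..m}. gen_idx (w k) = IE} = \<sigma> \<and> {k \<in> {1..m}. gen_idx (w k) = IN} = \<omega>}"

text \<open>
  Degrees are integers throughout; the groups are trivial in the degrees where no basis tensor lives.
\<close>
definition local_chain ::
    "nat \<Rightarrow> nat set set \<Rightarrow> nat set \<Rightarrow> nat set \<Rightarrow> int \<Rightarrow> (tensor \<Rightarrow>\<^sub>0 int) monoid" where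
  "local_chain m K \<sigma> \<omega> q =
     free_Abelian_group {w \<in> local_basis m K \<sigma> \<omega>. int (tensor_deg m w) = q}"

text \<open>
  The group of homomorphisms to the integers. Homomorphisms are taken to be extensional, so that
  equality of elements is equality of maps on the carrier.
\<close>
definition dual_group :: "('a, 'b) monoid_scheme \<Rightarrow> ('a \<Rightarrow> int) monoid" where
  "dual_group G =
     \<lparr>carrier = hom G integer_group \<inter> extensional (carrier G),
      monoid.mult = (\<lambda>f g. \<lambda>x\<in>carrier G. f x + g x),
      one = (\<lambda>x\<in>carrier G. 0)\<rparr>"

definition local_cochain ::
    "nat \<Rightarrow> nat set set \<Rightarrow> nat set \<Rightarrow> nat set \<Rightarrow> int \<Rightarrow> ((tensor \<Rightarrow>\<^sub>0 int) \<Rightarrow> int) monoid" where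
  "local_cochain m K \<sigma> \<omega> q = dual_group (local_chain m K \<sigma> \<omega> q)"

text \<open>
  The coboundary from degree \<open>q\<close> to degree \<open>q + 1\<close>. A sign depending only on the degree, as used in
  some conventions, would change neither cocycles nor coboundaries.
\<close>
definition local_codiff ::
    "nat \<Rightarrow> nat set set \<Rightarrow> nat set \<Rightarrow> nat set \<Rightarrow> int
      \<Rightarrow> ((tensor \<Rightarrow>\<^sub>0 int) \<Rightarrow> int) \<Rightarrow> ((tensor \<Rightarrow>\<^sub>0 int) \<Rightarrow> int)" where
  "local_codiff m K \<sigma> \<omega> q f =
     (\<lambda>c\<in>carrier (local_chain m K \<sigma> \<omega> (q + 1)). f (tensor_diff m c))"

definition homology_at ::
    "'a monoid \<Rightarrow> ('a \<Rightarrow> 'b) \<Rightarrow> 'b monoid \<Rightarrow> ('b \<Rightarrow> 'c) \<Rightarrow> 'c monoid \<Rightarrow> 'b set monoid" where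
  "homology_at A f B g C = subgroup_generated B (kernel B C g) Mod (f ` carrier A)"

definition local_homology ::
    "nat \<Rightarrow> nat set set \<Rightarrow> nat set \<Rightarrow> nat set \<Rightarrow> int \<Rightarrow> (tensor \<Rightarrow>\<^sub>0 int) set monoid" where
  "local_homology m K \<sigma> \<omega> q =
     homology_at (local_chain m K \<sigma> \<omega> (q + 1)) (tensor_diff m)
       (local_chain m K \<sigma> \<omega> q) (tensor_diff m) (local_chain m K \<sigma> \<omega> (q - 1))"

definition local_cohomology ::
    "nat \<Rightarrow> nat set set \<Rightarrow> nat set \<Rightarrow> nat set \<Rightarrow> int
      \<Rightarrow> ((tensor \<Rightarrow>\<^sub>0 int) \<Rightarrow> int) set monoid" where
  "local_cohomology m K \<sigma> \<omega> q =
     homology_at (local_cochain m K \<sigma> \<omega> (q - 1)) (local_codiff m K \<sigma> \<omega> (q - 1))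
       (local_cochain m K \<sigma> \<omega> q) (local_codiff m K \<sigma> \<omega> q) (local_cochain m K \<sigma> \<omega> (q + 1))"

end

theory Submission
  imports Defs
begin

text \<open>
  A basis tensor with index e exactly on \<open>\<sigma>\<close> and index n exactly on \<open>\<omega>\<close> is determined by the set
  \<open>\<tau> \<subseteq> \<omega>\<close> on which it equals n-bar, and it lies in \<open>T\<^sub>*(K)\<close> iff \<open>\<tau> \<union> \<sigma> \<in> K\<close>, that is, iff \<open>\<tau>\<close> is
  a face of the local complex. Replacing one n-bar by n deletes a vertex from \<open>\<tau>\<close>, with the Koszul
  sign \<open>(-1)\<close> to the number of smaller vertices of \<open>\<tau>\<close>. So the local chain complex is the augmented
  simplicial chain complex of \<open>L = K\<^bsub>\<sigma>,\<omega>\<^esub>\<close>, with a face of \<open>q\<close> vertices in degree \<open>q\<close>, and local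
  cohomology is the simplicial cohomology of \<open>L\<close> with the same shift
  (\<open>indexed_complex.local_homology_iso_simplicial\<close>,
  \<open>indexed_complex.local_cohomology_iso_simplicial\<close>). Since the equation
  \<open>(K\<^bsub>\<sigma>,\<omega>\<^esub>)\<degree> = (K\<degree>)\<^bsub>\<sigma>',\<omega>\<^esub>\<close> is a matter of complements (\<open>alexander_dual_local_complex\<close>),
  what remains is Alexander duality for \<open>L\<close> inside the full simplex on \<open>\<omega>\<close>
  (\<open>simplicial_alexander_duality\<close>).

  That duality joins two facts. The full simplex is acyclic: coning with its least vertex is a
  contracting homotopy (\<open>cone_homotopy\<close>). And \<open>\<tau> \<mapsto> \<omega> - \<tau>\<close> maps the non-faces of \<open>L\<close>
  onto the faces of \<open>L\<degree>\<close>, so with suitable signs it turns the relative chain complex of the pair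
  (full simplex, \<open>L\<close>) into the cochain complex of \<open>L\<degree>\<close> (\<open>to_dual_boundary\<close>). A cycle \<open>a\<close> of \<open>L\<close> is
  the boundary of its cone; the part of the cone outside \<open>L\<close>, read on complements, is a cocycle of
  \<open>L\<degree>\<close>. This assignment is the composite \<open>H\<^sub>q(L) \<cong> H\<^bsub>q+1\<^esub>(simplex, L) \<cong> H\<^bsup>n-q-1\<^esup>(L\<degree>)\<close>, where
  \<open>n\<close> is the number of vertices of \<open>\<omega>\<close> and the first isomorphism inverts the connecting map.

  Finally, \<open>\<gamma>\<degree>\<close> can be taken to be the inverse of the map \<open>\<gamma>\<close> of the dual data, because dualizing
  the data twice gives \<open>K\<close>, \<open>\<sigma>\<close> and the degree back.
\<close>

section \<open>Homology of a pair of composable homomorphisms\<close>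

locale composable_homs =
  A: comm_group A + B: comm_group B + C: comm_group C
  for A :: "'a monoid" and B :: "'b monoid" and C :: "'c monoid" +
  fixes f :: "'a \<Rightarrow> 'b" and g :: "'b \<Rightarrow> 'c"
  assumes f_hom: "f \<in> hom A B"
    and g_hom: "g \<in> hom B C"
    and g_f: "a \<in> carrier A \<Longrightarrow> g (f a) = \<one>\<^bsub>C\<^esub>"
begin

abbreviation cycle_group :: "'b monoid" where
  "cycle_group \<equiv> subgroup_generated B (kernel B C g)"

lemma kernel_subgroup: "subgroup (kernel B C g) B"
  by (simp add: B.group_axioms C.group_axioms g_hom group_hom.subgroup_kernel group_hom_axioms_def
      group_hom_def)

lemma carrier_cycle_group: "carrier cycle_group = kernel B C g"
  by (simp add: kernel_subgroup subgroup.carrier_subgroup_generated_subgroup)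

lemma mem_cycle_group: "b \<in> carrier cycle_group \<longleftrightarrow> b \<in> carrier B \<and> g b = \<one>\<^bsub>C\<^esub>"
  by (simp only: carrier_cycle_group) (simp add: kernel_def)

lemma comm_group_cycle_group: "comm_group cycle_group"
  by (rule B.abelian_subgroup_generated[OF B.comm_group_axioms])

lemma boundary_subset: "f ` carrier A \<subseteq> kernel B C g"
  using f_hom g_f by (auto simp: kernel_def hom_def)

lemma boundary_normal: "f ` carrier A \<lhd> cycle_group"
proof -
  interpret Z: comm_group cycle_group by (rule comm_group_cycle_group)
  have "subgroup (f ` carrier A) B"
    by (meson A.group_axioms B.group_axioms f_hom group_hom.img_is_subgroup group_hom.intro
        group_hom_axioms.intro)
  then have "subgroup (f ` carrier A) cycle_group"
    using B.subgroup_of_subgroup_generated boundary_subset by blast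
  then show ?thesis
    by (simp add: Z.normal_iff_subgroup)
qed

lemma group_homology_at: "group (homology_at A f B g C)"
  unfolding homology_at_def by (rule normal.factorgroup_is_group [OF boundary_normal])

end

text \<open>
  Surjectivity is asked up to boundaries only, since the duality map below, which cones a cycle first,
  reaches a cocycle only up to a coboundary. Composing \<open>\<gamma>\<close> with the projection to homology and
  applying the first isomorphism theorem gives the isomorphism.
\<close>
lemma homology_at_isoI:
  assumes "composable_homs A B C f g" and "composable_homs A' B' C' f' g'"
    and \<gamma>: "\<gamma> \<in> hom B B'"
    and cycle: "\<And>b. b \<in> carrier B \<Longrightarrow> g b = \<one>\<^bsub>C\<^esub> \<Longrightarrow> g' (\<gamma> b) = \<one>\<^bsub>C'\<^esub>"
    and boundary: "\<And>b. b \<in> carrier B \<Longrightarrow> g b = \<one>\<^bsub>C\<^esub> \<Longrightarrow>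
                     \<gamma> b \<in> f' ` carrier A' \<longleftrightarrow> b \<in> f ` carrier A"
    and onto: "\<And>b'. b' \<in> carrier B' \<Longrightarrow> g' b' = \<one>\<^bsub>C'\<^esub> \<Longrightarrow>
                 \<exists>b\<in>carrier B. g b = \<one>\<^bsub>C\<^esub> \<and> (\<exists>a'\<in>carrier A'. b' = f' a' \<otimes>\<^bsub>B'\<^esub> \<gamma> b)"
  shows "homology_at A f B g C \<cong> homology_at A' f' B' g' C'"
proof -
  interpret X: composable_homs A B C f g by fact
  interpret Y: composable_homs A' B' C' f' g' by fact
  interpret N: normal "f' ` carrier A'" Y.cycle_group by (rule Y.boundary_normal)
  interpret ZX: comm_group X.cycle_group by (rule X.comm_group_cycle_group)
  define \<phi> where "\<phi> = (\<lambda>b. (f' ` carrier A') #>\<^bsub>Y.cycle_group\<^esub> b) \<circ> \<gamma>"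
  have \<gamma>_cycle: "\<gamma> b \<in> carrier Y.cycle_group" if "b \<in> carrier X.cycle_group" for b
    using that \<gamma> cycle
    unfolding X.mem_cycle_group Y.mem_cycle_group by (auto simp: hom_def)
  have "\<gamma> \<in> hom X.cycle_group Y.cycle_group"
  proof (rule homI)
    show "\<gamma> (x \<otimes>\<^bsub>X.cycle_group\<^esub> y) = \<gamma> x \<otimes>\<^bsub>Y.cycle_group\<^esub> \<gamma> y"
      if "x \<in> carrier X.cycle_group" "y \<in> carrier X.cycle_group" for x y
      using that \<gamma> unfolding X.mem_cycle_group by (simp add: hom_def)
  qed (rule \<gamma>_cycle)
  then have hom: "\<phi> \<in> hom X.cycle_group (homology_at A' f' B' g' C')"
    unfolding \<phi>_def homology_at_def using N.r_coset_hom_Mod by (rule hom_compose)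
  interpret H: group_hom X.cycle_group "homology_at A' f' B' g' C'" \<phi>
    by (intro group_hom.intro group_hom_axioms.intro hom ZX.group_axioms Y.group_homology_at)
  have coset_one: "(f' ` carrier A') #>\<^bsub>Y.cycle_group\<^esub> y = f' ` carrier A' \<longleftrightarrow> y \<in> f' ` carrier A'"
    if "y \<in> carrier Y.cycle_group" for y
    using that N.subgroup_axioms
    by (metis N.is_group N.rcos_const group.coset_join1 subgroup.rcos_const)
  have "kernel X.cycle_group (homology_at A' f' B' g' C') \<phi> = f ` carrier A"
  proof -
    have "\<phi> b = \<one>\<^bsub>homology_at A' f' B' g' C'\<^esub> \<longleftrightarrow> b \<in> f ` carrier A"
      if "b \<in> carrier X.cycle_group" for b
      using coset_one[OF \<gamma>_cycle[OF that]] boundary[of b] that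
      unfolding X.mem_cycle_group by (simp add: \<phi>_def homology_at_def)
    then show ?thesis
      using X.boundary_subset unfolding kernel_def[of "X.cycle_group"] X.carrier_cycle_group by blast
  qed
  moreover have "\<phi> ` carrier X.cycle_group = carrier (homology_at A' f' B' g' C')"
  proof
    show "\<phi> ` carrier X.cycle_group \<subseteq> carrier (homology_at A' f' B' g' C')"
      using H.hom_closed by blast
    show "carrier (homology_at A' f' B' g' C') \<subseteq> \<phi> ` carrier X.cycle_group"
    proof
      fix y assume "y \<in> carrier (homology_at A' f' B' g' C')"
      then obtain b' where b': "b' \<in> carrier Y.cycle_group"
        and y: "y = (f' ` carrier A') #>\<^bsub>Y.cycle_group\<^esub> b'"
        by (auto simp: homology_at_def carrier_FactGroup)
      from b' obtain b a' where b: "b \<in> carrier B" "g b = \<one>\<^bsub>C\<^esub>" and a': "a' \<in> carrier A'"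
        and eq: "b' = f' a' \<otimes>\<^bsub>B'\<^esub> \<gamma> b"
        using onto[of b'] unfolding Y.mem_cycle_group by blast
      have bZ: "b \<in> carrier X.cycle_group"
        using b unfolding X.mem_cycle_group by blast
      have "b' \<in> (f' ` carrier A') #>\<^bsub>Y.cycle_group\<^esub> \<gamma> b"
        using a' eq by (auto simp: r_coset_def)
      then have "y = (f' ` carrier A') #>\<^bsub>Y.cycle_group\<^esub> \<gamma> b"
        using y \<gamma>_cycle[OF bZ] N.subgroup_axioms N.is_group
        by (metis group.repr_independence)
      then show "y \<in> \<phi> ` carrier X.cycle_group"
        using bZ by (auto simp: \<phi>_def)
    qed
  qed
  ultimately show ?thesis
    using H.FactGroup_iso_set unfolding is_iso_def homology_at_def[of A] by (metis empty_iff)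
qed

text \<open>
  Isomorphisms that commute with \<open>f\<close> and \<open>g\<close> as mere functions suffice: injectivity of \<open>\<beta>\<close> and \<open>\<gamma>\<close>
  carries the homomorphism property of \<open>f\<close> and \<open>g\<close>, and the vanishing of their composite, back from
  the target.
\<close>
lemma composable_homs_transfer:
  assumes "composable_homs A' B' C' f' g'"
    and "comm_group A" "comm_group B" "comm_group C"
    and \<alpha>: "\<alpha> \<in> iso A A'" and \<beta>: "\<beta> \<in> iso B B'" and \<gamma>: "\<gamma> \<in> iso C C'"
    and f: "f \<in> carrier A \<rightarrow> carrier B" and g: "g \<in> carrier B \<rightarrow> carrier C"
    and \<beta>_f: "\<And>a. a \<in> carrier A \<Longrightarrow> \<beta> (f a) = f' (\<alpha> a)"
    and \<gamma>_g: "\<And>b. b \<in> carrier B \<Longrightarrow> \<gamma> (g b) = g' (\<beta> b)"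
  shows "composable_homs A B C f g" and "homology_at A f B g C \<cong> homology_at A' f' B' g' C'"
proof -
  interpret Y: composable_homs A' B' C' f' g' by fact
  interpret A: comm_group A by fact
  interpret B: comm_group B by fact
  interpret C: comm_group C by fact
  have transfer_hom: "h \<in> hom G H"
    if "comm_group G" "comm_group H" "h \<in> carrier G \<rightarrow> carrier H" "h' \<in> hom G' H'"
      "\<phi> \<in> iso G G'" "\<psi> \<in> iso H H'" "\<And>x. x \<in> carrier G \<Longrightarrow> \<psi> (h x) = h' (\<phi> x)"
    for G :: "'u monoid" and G' :: "'v monoid" and H :: "'w monoid" and H' :: "'x monoid" and h h' \<phi> \<psi>
  proof (rule homI)
    interpret G: comm_group G by fact
    interpret H: comm_group H by fact
    show hx: "h x \<in> carrier H" if "x \<in> carrier G" for x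
      using that \<open>h \<in> carrier G \<rightarrow> carrier H\<close> by blast
    fix x y assume x: "x \<in> carrier G" and y: "y \<in> carrier G"
    have "\<psi> (h (x \<otimes>\<^bsub>G\<^esub> y)) = \<psi> (h x \<otimes>\<^bsub>H\<^esub> h y)"
      using x y that(4-7) hx by (simp add: iso_def hom_def Pi_iff)
    then show "h (x \<otimes>\<^bsub>G\<^esub> y) = h x \<otimes>\<^bsub>H\<^esub> h y"
      using x y hx \<open>\<psi> \<in> iso H H'\<close> by (metis G.m_closed H.m_closed inj_on_eq_iff iso_iff)
  qed
  have inj: "inj_on \<beta> (carrier B)" "inj_on \<gamma> (carrier C)"
    and onto: "\<alpha> ` carrier A = carrier A'" "\<beta> ` carrier B = carrier B'"
    and \<beta>_hom: "\<beta> \<in> hom B B'" and \<gamma>_hom: "\<gamma> \<in> hom C C'"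
    using \<alpha> \<beta> \<gamma> by (auto simp: iso_iff)
  have \<gamma>_one: "\<gamma> c = \<one>\<^bsub>C'\<^esub> \<longleftrightarrow> c = \<one>\<^bsub>C\<^esub>" if "c \<in> carrier C" for c
    using that inj(2) hom_one[OF \<gamma>_hom C.group_axioms Y.C.group_axioms] by (metis C.one_closed inj_on_eq_iff)
  show *: "composable_homs A B C f g"
  proof unfold_locales
    show "f \<in> hom A B" by (rule transfer_hom[OF assms(2,3) f Y.f_hom \<alpha> \<beta> \<beta>_f])
    show "g \<in> hom B C" by (rule transfer_hom[OF assms(3,4) g Y.g_hom \<beta> \<gamma> \<gamma>_g])
    fix a assume a: "a \<in> carrier A"
    have "f a \<in> carrier B" and "\<alpha> a \<in> carrier A'"
      using a f onto(1) by blast+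
    then have "\<gamma> (g (f a)) = \<one>\<^bsub>C'\<^esub>"
      using \<gamma>_g \<beta>_f[OF a] Y.g_f by simp
    then show "g (f a) = \<one>\<^bsub>C\<^esub>"
      using \<gamma>_one a f g by blast
  qed
  show "homology_at A f B g C \<cong> homology_at A' f' B' g' C'"
  proof (rule homology_at_isoI[OF * assms(1) \<beta>_hom])
    fix b assume b: "b \<in> carrier B" and gb: "g b = \<one>\<^bsub>C\<^esub>"
    show "g' (\<beta> b) = \<one>\<^bsub>C'\<^esub>"
      using \<gamma>_g[OF b] gb \<gamma>_one[of "g b"] by simp
    have "\<beta> b \<in> f' ` carrier A' \<longleftrightarrow> (\<exists>a\<in>carrier A. \<beta> b = \<beta> (f a))"
      by (simp add: \<beta>_f image_iff flip: onto(1))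
    also have "\<dots> \<longleftrightarrow> b \<in> f ` carrier A"
      using b f inj(1) by (auto simp: inj_on_eq_iff image_iff Pi_iff)
    finally show "\<beta> b \<in> f' ` carrier A' \<longleftrightarrow> b \<in> f ` carrier A" .
  next
    fix b' assume "b' \<in> carrier B'" and g'b': "g' b' = \<one>\<^bsub>C'\<^esub>"
    then obtain b where b: "b \<in> carrier B" "b' = \<beta> b"
      using onto(2) by blast
    then have "g b = \<one>\<^bsub>C\<^esub>"
      using \<gamma>_g[of b] g'b' \<gamma>_one[of "g b"] g by auto
    moreover have "b' = f' \<one>\<^bsub>A'\<^esub> \<otimes>\<^bsub>B'\<^esub> \<beta> b"
      using b hom_one[OF Y.f_hom Y.A.group_axioms Y.B.group_axioms] \<open>b' \<in> carrier B'\<close> by simp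
    ultimately show "\<exists>b\<in>carrier B. g b = \<one>\<^bsub>C\<^esub> \<and> (\<exists>a'\<in>carrier A'. b' = f' a' \<otimes>\<^bsub>B'\<^esub> \<beta> b)"
      using b(1) by blast
  qed
qed


section \<open>Simplicial chains as integer-valued functions\<close>

text \<open>
  Over a finite set of faces, chains and cochains are both integer functions on the faces. Encoding
  both as functions on all sets that vanish off the faces lets the duality map between them be a
  plain change of variables.
\<close>
definition supported_functions :: "nat set set \<Rightarrow> (nat set \<Rightarrow> int) monoid" where
  "supported_functions P =
     \<lparr>carrier = {a. \<forall>\<tau>. \<tau> \<notin> P \<longrightarrow> a \<tau> = 0}, monoid.mult = (\<lambda>a b \<tau>. a \<tau> + b \<tau>), one = (\<lambda>_. 0)\<rparr>"

definition faces :: "nat set set \<Rightarrow> int \<Rightarrow> nat set set" where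
  "faces L q = {\<tau> \<in> L. int (card \<tau>) = q}"

text \<open>
  For \<open>k \<in> \<tau>\<close> this is the incidence number of \<open>\<tau> - {k}\<close> in \<open>\<tau>\<close>. Membership of \<open>k\<close> in \<open>\<tau>\<close> does not
  affect it, so it can be evaluated at either of the two faces.
\<close>
definition face_sign :: "nat \<Rightarrow> nat set \<Rightarrow> int" where
  "face_sign k \<tau> = (-1) ^ card (\<tau> \<inter> {..<k})"

text \<open>
  The coefficient at \<open>\<tau>\<close> collects the faces that have \<open>\<tau>\<close> as a facet. It is formed in the full
  simplex on \<open>\<omega>\<close>, so one operator serves every complex on \<open>\<omega>\<close>; the truncation to subsets of \<open>\<omega>\<close>
  keeps the values inside the chains of that simplex.
\<close>
definition boundary :: "nat set \<Rightarrow> (nat set \<Rightarrow> int) \<Rightarrow> nat set \<Rightarrow> int" where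
  "boundary \<omega> a \<tau> = (if \<tau> \<subseteq> \<omega> then \<Sum>k\<in>\<omega> - \<tau>. face_sign k \<tau> * a (insert k \<tau>) else 0)"

text \<open>
  Unlike the boundary, the coboundary leads out of a subcomplex, hence the truncation to \<open>L\<close>.
\<close>
definition coboundary :: "nat set set \<Rightarrow> (nat set \<Rightarrow> int) \<Rightarrow> nat set \<Rightarrow> int" where
  "coboundary L a \<rho> = (if \<rho> \<in> L then \<Sum>k\<in>\<rho>. face_sign k \<rho> * a (\<rho> - {k}) else 0)"

definition simplicial_homology :: "nat set \<Rightarrow> nat set set \<Rightarrow> int \<Rightarrow> (nat set \<Rightarrow> int) set monoid" where
  "simplicial_homology \<omega> L q =
     homology_at (supported_functions (faces L (q + 1))) (boundary \<omega>)
       (supported_functions (faces L q)) (boundary \<omega>) (supported_functions (faces L (q - 1)))"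

definition simplicial_cohomology :: "nat set set \<Rightarrow> int \<Rightarrow> (nat set \<Rightarrow> int) set monoid" where
  "simplicial_cohomology L q =
     homology_at (supported_functions (faces L (q - 1))) (coboundary L)
       (supported_functions (faces L q)) (coboundary L) (supported_functions (faces L (q + 1)))"

lemma carrier_supported_functions:
  "a \<in> carrier (supported_functions P) \<longleftrightarrow> (\<forall>\<tau>. \<tau> \<notin> P \<longrightarrow> a \<tau> = 0)"
  by (simp add: supported_functions_def)

lemma mult_supported_functions [simp]: "a \<otimes>\<^bsub>supported_functions P\<^esub> b = (\<lambda>\<tau>. a \<tau> + b \<tau>)"
  by (simp add: supported_functions_def)

lemma one_supported_functions [simp]: "\<one>\<^bsub>supported_functions P\<^esub> = (\<lambda>_. 0)"
  by (simp add: supported_functions_def)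

lemma comm_group_supported_functions: "comm_group (supported_functions P)"
proof (rule comm_groupI)
  fix a assume "a \<in> carrier (supported_functions P)"
  then show "\<exists>b\<in>carrier (supported_functions P). b \<otimes>\<^bsub>supported_functions P\<^esub> a = \<one>\<^bsub>supported_functions P\<^esub>"
    by (intro bexI[of _ "\<lambda>\<tau>. - a \<tau>"]) (auto simp: carrier_supported_functions)
qed (auto simp: carrier_supported_functions algebra_simps)

lemma face_sign_remove_self [simp]: "face_sign k (\<tau> - {k}) = face_sign k \<tau>"
proof -
  have "(\<tau> - {k}) \<inter> {..<k} = \<tau> \<inter> {..<k}" by auto
  then show ?thesis by (simp add: face_sign_def)
qed

lemma face_sign_insert:
  assumes "l \<notin> \<tau>"
  shows "face_sign k (insert l \<tau>) = (if l < k then - face_sign k \<tau> else face_sign k \<tau>)"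
  using assms by (simp add: face_sign_def)

lemma face_sign_square: "face_sign k \<tau> * face_sign k \<tau> = 1"
  by (simp add: face_sign_def flip: power_add mult_2)

lemma face_sign_partition:
  assumes "\<tau> \<subseteq> \<omega>"
  shows "face_sign k \<omega> = face_sign k \<tau> * face_sign k (\<omega> - \<tau>)"
proof -
  have "\<omega> \<inter> {..<k} = \<tau> \<inter> {..<k} \<union> (\<omega> - \<tau>) \<inter> {..<k}"
    using assms by auto
  moreover have "card \<dots> = card (\<tau> \<inter> {..<k}) + card ((\<omega> - \<tau>) \<inter> {..<k})"
    by (rule card_Un_disjoint) auto
  ultimately show ?thesis
    by (simp add: face_sign_def power_add)
qed

lemma boundary_add: "boundary \<omega> (\<lambda>\<tau>. a \<tau> + b \<tau>) = (\<lambda>\<tau>. boundary \<omega> a \<tau> + boundary \<omega> b \<tau>)"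
  by (auto simp: boundary_def sum.distrib algebra_simps)

lemma boundary_diff: "boundary \<omega> (\<lambda>\<tau>. a \<tau> - b \<tau>) = (\<lambda>\<tau>. boundary \<omega> a \<tau> - boundary \<omega> b \<tau>)"
  by (auto simp: boundary_def sum_subtractf algebra_simps)

lemma boundary_zero: "boundary \<omega> (\<lambda>_. 0) = (\<lambda>_. 0)"
  by (auto simp: boundary_def)

lemma coboundary_add:
  "coboundary L (\<lambda>\<tau>. a \<tau> + b \<tau>) = (\<lambda>\<tau>. coboundary L a \<tau> + coboundary L b \<tau>)"
  by (auto simp: coboundary_def sum.distrib algebra_simps)

text \<open>
  Deleting two vertices in either order gives the same face with opposite signs.
\<close>
lemma boundary_boundary:
  assumes "finite \<omega>"
  shows "boundary \<omega> (boundary \<omega> a) = (\<lambda>_. 0)"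
proof
  fix \<tau>
  show "boundary \<omega> (boundary \<omega> a) \<tau> = 0"
  proof (cases "\<tau> \<subseteq> \<omega>")
    case True
    define F where "F k l = (if k = l then 0 else
        face_sign k \<tau> * face_sign l (insert k \<tau>) * a (insert l (insert k \<tau>)))" for k l
    have "boundary \<omega> (boundary \<omega> a) \<tau> =
        (\<Sum>k\<in>\<omega> - \<tau>. face_sign k \<tau> *
           (\<Sum>l\<in>\<omega> - insert k \<tau>. face_sign l (insert k \<tau>) * a (insert l (insert k \<tau>))))"
      using True by (auto simp: boundary_def intro!: sum.cong)
    also have "\<dots> = (\<Sum>k\<in>\<omega> - \<tau>. \<Sum>l\<in>\<omega> - \<tau>. F k l)"
    proof (rule sum.cong[OF refl])
      fix k assume k: "k \<in> \<omega> - \<tau>"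
      have "(\<Sum>l\<in>\<omega> - \<tau>. F k l) = (\<Sum>l\<in>\<omega> - insert k \<tau>. F k l)"
        using assms by (intro sum.mono_neutral_right) (auto simp: F_def)
      also have "\<dots> = (\<Sum>l\<in>\<omega> - insert k \<tau>. face_sign k \<tau> *
                        (face_sign l (insert k \<tau>) * a (insert l (insert k \<tau>))))"
        by (intro sum.cong) (auto simp: F_def)
      finally show "face_sign k \<tau> * (\<Sum>l\<in>\<omega> - insert k \<tau>.
          face_sign l (insert k \<tau>) * a (insert l (insert k \<tau>))) = (\<Sum>l\<in>\<omega> - \<tau>. F k l)"
        by (simp add: sum_distrib_left)
    qed
    finally have sum: "boundary \<omega> (boundary \<omega> a) \<tau> = (\<Sum>k\<in>\<omega> - \<tau>. \<Sum>l\<in>\<omega> - \<tau>. F k l)" .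
    have antisym: "F k l = - F l k" if "k \<in> \<omega> - \<tau>" "l \<in> \<omega> - \<tau>" for k l
      using that by (auto simp: F_def face_sign_insert insert_commute)
    have "(\<Sum>k\<in>\<omega> - \<tau>. \<Sum>l\<in>\<omega> - \<tau>. F k l) = (\<Sum>k\<in>\<omega> - \<tau>. \<Sum>l\<in>\<omega> - \<tau>. - F l k)"
      by (intro sum.cong refl antisym)
    also have "\<dots> = - (\<Sum>k\<in>\<omega> - \<tau>. \<Sum>l\<in>\<omega> - \<tau>. F k l)"
      by (subst sum.swap) (simp add: sum_negf)
    finally show ?thesis
      using sum by simp
  qed (simp add: boundary_def)
qed

lemma simplicial_complex_onD:
  assumes "simplicial_complex_on S L"
  shows "finite S" and "\<tau> \<in> L \<Longrightarrow> \<tau> \<subseteq> S" and "\<tau> \<in> L \<Longrightarrow> \<tau>' \<subseteq> \<tau> \<Longrightarrow> \<tau>' \<in> L"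
  using assms by (auto simp: simplicial_complex_on_def)

lemma boundary_closed:
  assumes "simplicial_complex_on \<omega> L" and a: "a \<in> carrier (supported_functions (faces L q))"
  shows "boundary \<omega> a \<in> carrier (supported_functions (faces L (q - 1)))"
  unfolding carrier_supported_functions
proof (intro allI impI)
  note L = simplicial_complex_onD[OF assms(1)]
  fix \<tau> assume \<tau>: "\<tau> \<notin> faces L (q - 1)"
  have "a (insert k \<tau>) = 0" if "\<tau> \<subseteq> \<omega>" "k \<in> \<omega> - \<tau>" for k
  proof -
    have "card (insert k \<tau>) = Suc (card \<tau>)"
      using that finite_subset[OF that(1) L(1)] by simp
    then have "insert k \<tau> \<notin> faces L q"
      using \<tau> L(3)[of "insert k \<tau>" \<tau>] by (force simp: faces_def)
    then show ?thesis
      using a by (simp add: carrier_supported_functions)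
  qed
  then show "boundary \<omega> a \<tau> = 0"
    by (simp add: boundary_def)
qed

lemma coboundary_closed:
  assumes "simplicial_complex_on \<omega> L" and a: "a \<in> carrier (supported_functions (faces L q))"
  shows "coboundary L a \<in> carrier (supported_functions (faces L (q + 1)))"
  unfolding carrier_supported_functions
proof (intro allI impI)
  note L = simplicial_complex_onD[OF assms(1)]
  fix \<rho> assume \<rho>: "\<rho> \<notin> faces L (q + 1)"
  have "a (\<rho> - {k}) = 0" if "\<rho> \<in> L" "k \<in> \<rho>" for k
  proof -
    have "Suc (card (\<rho> - {k})) = card \<rho>"
      using that card_Suc_Diff1[of \<rho> k] finite_subset[OF L(2) L(1)] by simp
    then have "\<rho> - {k} \<notin> faces L q"
      using \<rho> that(1) by (force simp: faces_def)
    then show ?thesis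
      using a by (simp add: carrier_supported_functions)
  qed
  then show "coboundary L a \<rho> = 0"
    by (simp add: coboundary_def)
qed

lemma composable_boundaries:
  assumes "simplicial_complex_on \<omega> L"
  shows "composable_homs (supported_functions (faces L (q + 1))) (supported_functions (faces L q))
           (supported_functions (faces L (q - 1))) (boundary \<omega>) (boundary \<omega>)"
proof (intro composable_homs.intro composable_homs_axioms.intro comm_group_supported_functions)
  show "boundary \<omega> \<in> hom (supported_functions (faces L (q + 1))) (supported_functions (faces L q))"
    using boundary_closed[OF assms, of _ "q + 1"] by (intro homI) (simp_all add: boundary_add)
  show "boundary \<omega> \<in> hom (supported_functions (faces L q)) (supported_functions (faces L (q - 1)))"
    using boundary_closed[OF assms, of _ q] by (intro homI) (simp_all add: boundary_add)
qed (simp add: boundary_boundary simplicial_complex_onD(1)[OF assms])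


section \<open>Alexander duality for simplicial complexes\<close>

lemma alexander_dual_iff:
  "\<rho> \<in> alexander_dual S L \<longleftrightarrow> \<rho> \<subseteq> S \<and> S - \<rho> \<notin> L"
proof
  assume "\<rho> \<in> alexander_dual S L"
  then obtain \<tau> where "\<rho> = S - \<tau>" "\<tau> \<subseteq> S" "\<tau> \<notin> L"
    by (auto simp: alexander_dual_def)
  then show "\<rho> \<subseteq> S \<and> S - \<rho> \<notin> L"
    by (simp add: double_diff Diff_subset)
next
  assume \<rho>: "\<rho> \<subseteq> S \<and> S - \<rho> \<notin> L"
  then have "\<rho> = S - (S - \<rho>)"
    by blast
  then show "\<rho> \<in> alexander_dual S L"
    using \<rho> unfolding alexander_dual_def by blast
qed

lemma simplicial_complex_alexander_dual:
  assumes "simplicial_complex_on S L"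
  shows "simplicial_complex_on S (alexander_dual S L)"
proof -
  have "\<tau>' \<in> alexander_dual S L" if "\<tau> \<in> alexander_dual S L" "\<tau>' \<subseteq> \<tau>" for \<tau> \<tau>'
    using that simplicial_complex_onD(3)[OF assms, of "S - \<tau>'" "S - \<tau>"]
    unfolding alexander_dual_iff by blast
  moreover have "alexander_dual S L \<subseteq> Pow S"
    by (auto simp: alexander_dual_iff)
  ultimately show ?thesis
    using simplicial_complex_onD(1)[OF assms] unfolding simplicial_complex_on_def by blast
qed

lemma alexander_dual_dual:
  assumes "simplicial_complex_on S L"
  shows "alexander_dual S (alexander_dual S L) = L"
proof (rule Set.set_eqI)
  fix \<tau>
  have "S - (S - \<tau>) = \<tau>" if "\<tau> \<subseteq> S"
    using that by blast
  then show "\<tau> \<in> alexander_dual S (alexander_dual S L) \<longleftrightarrow> \<tau> \<in> L"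
    using simplicial_complex_onD(2)[OF assms, of \<tau>] unfolding alexander_dual_iff by auto
qed

text \<open>
  With these signs complementation intertwines boundary and coboundary: deleting \<open>k\<close> from \<open>\<rho>\<close>
  changes the product by the sign of \<open>k\<close> in \<open>\<omega>\<close>, which is the product of its signs in \<open>\<rho>\<close> and in
  \<open>\<omega> - \<rho>\<close>.
\<close>
definition dual_sign :: "nat set \<Rightarrow> nat set \<Rightarrow> int" where
  "dual_sign \<omega> \<rho> = (\<Prod>k\<in>\<rho>. face_sign k \<omega>)"

text \<open>
  Only the values of \<open>a\<close> on non-faces of \<open>L\<close> enter, so on chains of the full simplex this is the
  projection to relative chains followed by complementation.
\<close>
definition to_dual :: "nat set \<Rightarrow> nat set set \<Rightarrow> (nat set \<Rightarrow> int) \<Rightarrow> nat set \<Rightarrow> int" where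
  "to_dual \<omega> L a \<rho> = (if \<rho> \<in> alexander_dual \<omega> L then dual_sign \<omega> \<rho> * a (\<omega> - \<rho>) else 0)"

definition from_dual :: "nat set \<Rightarrow> (nat set \<Rightarrow> int) \<Rightarrow> nat set \<Rightarrow> int" where
  "from_dual \<omega> f \<tau> = (if \<tau> \<subseteq> \<omega> then dual_sign \<omega> (\<omega> - \<tau>) * f (\<omega> - \<tau>) else 0)"

text \<open>
  The cone over a face containing the apex is degenerate and counts as zero. Taking the least vertex as apex
  makes the sign of the apex in every face equal to 1.
\<close>
definition cone_chain :: "nat set \<Rightarrow> (nat set \<Rightarrow> int) \<Rightarrow> nat set \<Rightarrow> int" where
  "cone_chain \<omega> a \<tau> = (if \<tau> \<subseteq> \<omega> \<and> Min \<omega> \<in> \<tau> then a (\<tau> - {Min \<omega>}) else 0)"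

lemma dual_sign_remove:
  assumes "finite \<rho>" "k \<in> \<rho>"
  shows "dual_sign \<omega> (\<rho> - {k}) = face_sign k \<omega> * dual_sign \<omega> \<rho>"
  using prod.remove[OF assms, of "\<lambda>k. face_sign k \<omega>"]
  by (simp add: dual_sign_def face_sign_square flip: mult.assoc)

lemma dual_sign_square: "dual_sign \<omega> \<rho> * dual_sign \<omega> \<rho> = 1"
  by (simp add: dual_sign_def face_sign_square flip: prod.distrib)

lemma to_dual_add: "to_dual \<omega> L (\<lambda>\<tau>. a \<tau> + b \<tau>) = (\<lambda>\<tau>. to_dual \<omega> L a \<tau> + to_dual \<omega> L b \<tau>)"
  by (auto simp: to_dual_def algebra_simps)

lemma to_dual_diff: "to_dual \<omega> L (\<lambda>\<tau>. a \<tau> - b \<tau>) = (\<lambda>\<tau>. to_dual \<omega> L a \<tau> - to_dual \<omega> L b \<tau>)"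
  by (auto simp: to_dual_def algebra_simps)

lemma cone_chain_add: "cone_chain \<omega> (\<lambda>\<tau>. a \<tau> + b \<tau>) = (\<lambda>\<tau>. cone_chain \<omega> a \<tau> + cone_chain \<omega> b \<tau>)"
  by (auto simp: cone_chain_def)

lemma cone_chain_zero: "cone_chain \<omega> (\<lambda>_. 0) = (\<lambda>_. 0)"
  by (auto simp: cone_chain_def)

text \<open>
  Deleting the apex from the cone over a face returns the face, with sign 1 as the apex is least.
  Deleting any other vertex gives the cone over a facet, with the opposite sign to the one before
  coning since one smaller vertex has been added. For a face that contains the apex, only the facet
  opposite to the apex survives coning, and its cone is the face.
\<close>
lemma cone_homotopy:
  assumes "finite \<omega>" "\<omega> \<noteq> {}" and a: "\<And>\<tau>. \<not> \<tau> \<subseteq> \<omega> \<Longrightarrow> a \<tau> = 0"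
  shows "boundary \<omega> (cone_chain \<omega> a) = (\<lambda>\<tau>. a \<tau> - cone_chain \<omega> (boundary \<omega> a) \<tau>)"
proof
  fix \<tau>
  define v where "v = Min \<omega>"
  have v: "v \<in> \<omega>" and v_le: "\<And>k. k \<in> \<omega> \<Longrightarrow> v \<le> k"
    using assms by (auto simp: v_def)
  consider "\<not> \<tau> \<subseteq> \<omega>" | "\<tau> \<subseteq> \<omega>" "v \<notin> \<tau>" | "\<tau> \<subseteq> \<omega>" "v \<in> \<tau>"
    by blast
  then show "boundary \<omega> (cone_chain \<omega> a) \<tau> = a \<tau> - cone_chain \<omega> (boundary \<omega> a) \<tau>"
  proof cases
    case 1
    then show ?thesis by (simp add: boundary_def cone_chain_def a)
  next
    case 2
    have "\<tau> \<inter> {..<v} = {}"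
      using 2(1) v_le leD by blast
    then have sign: "face_sign v \<tau> = 1"
      by (simp add: face_sign_def)
    have "boundary \<omega> (cone_chain \<omega> a) \<tau> = (\<Sum>k\<in>\<omega> - \<tau>. if k = v then a \<tau> else 0)"
      using 2 sign by (auto simp: boundary_def cone_chain_def simp flip: v_def intro!: sum.cong)
    also have "\<dots> = a \<tau>"
      using 2 v assms(1) by (simp add: sum.delta)
    finally show ?thesis
      using 2 by (simp add: cone_chain_def flip: v_def)
  next
    case 3
    define \<tau>\<^sub>0 where "\<tau>\<^sub>0 = \<tau> - {v}"
    have \<tau>: "\<tau> = insert v \<tau>\<^sub>0" and v\<tau>: "v \<notin> \<tau>\<^sub>0" and sub: "\<tau>\<^sub>0 \<subseteq> \<omega>"
      using 3 by (auto simp: \<tau>\<^sub>0_def)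
    have "\<tau>\<^sub>0 \<inter> {..<v} = {}"
      using sub v_le leD by blast
    then have sign: "face_sign v \<tau>\<^sub>0 = 1"
      by (simp add: face_sign_def)
    have "cone_chain \<omega> (boundary \<omega> a) \<tau> = (\<Sum>k\<in>\<omega> - \<tau>\<^sub>0. face_sign k \<tau>\<^sub>0 * a (insert k \<tau>\<^sub>0))"
      using 3 sub by (simp add: cone_chain_def boundary_def flip: v_def \<tau>\<^sub>0_def)
    also have "\<omega> - \<tau>\<^sub>0 = insert v (\<omega> - \<tau>)"
      using v v\<tau> \<tau> by auto
    also have "(\<Sum>k\<in>insert v (\<omega> - \<tau>). face_sign k \<tau>\<^sub>0 * a (insert k \<tau>\<^sub>0)) =
        a \<tau> + (\<Sum>k\<in>\<omega> - \<tau>. face_sign k \<tau>\<^sub>0 * a (insert k \<tau>\<^sub>0))"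
      using assms(1) 3 \<tau> sign by (subst sum.insert) auto
    finally have 1: "cone_chain \<omega> (boundary \<omega> a) \<tau> =
        a \<tau> + (\<Sum>k\<in>\<omega> - \<tau>. face_sign k \<tau>\<^sub>0 * a (insert k \<tau>\<^sub>0))" .
    have "boundary \<omega> (cone_chain \<omega> a) \<tau> = (\<Sum>k\<in>\<omega> - \<tau>. face_sign k \<tau> * cone_chain \<omega> a (insert k \<tau>))"
      using 3 by (simp add: boundary_def)
    also have "\<dots> = (\<Sum>k\<in>\<omega> - \<tau>. - (face_sign k \<tau>\<^sub>0 * a (insert k \<tau>\<^sub>0)))"
    proof (rule sum.cong[OF refl])
      fix k assume k: "k \<in> \<omega> - \<tau>"
      then have "v < k"
        using v_le[of k] 3 by (metis DiffE le_neq_implies_less)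
      then have "face_sign k \<tau> = - face_sign k \<tau>\<^sub>0"
        using v\<tau> by (simp add: \<tau> face_sign_insert)
      moreover have "insert k \<tau> - {v} = insert k \<tau>\<^sub>0"
        using \<open>v < k\<close> by (auto simp: \<tau>\<^sub>0_def)
      then have "cone_chain \<omega> a (insert k \<tau>) = a (insert k \<tau>\<^sub>0)"
        using k 3 by (simp add: cone_chain_def flip: v_def)
      ultimately show "face_sign k \<tau> * cone_chain \<omega> a (insert k \<tau>) = - (face_sign k \<tau>\<^sub>0 * a (insert k \<tau>\<^sub>0))"
        by simp
    qed
    finally show ?thesis
      using 1 by (simp add: sum_negf)
  qed
qed

text \<open>
  The non-faces are closed under adding vertices of \<open>\<omega>\<close>, and adding a vertex to \<open>\<omega> - \<rho>\<close> is the same as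
  deleting it from \<open>\<rho>\<close>.
\<close>
lemma to_dual_boundary:
  assumes "simplicial_complex_on \<omega> L"
  shows "to_dual \<omega> L (boundary \<omega> a) = coboundary (alexander_dual \<omega> L) (to_dual \<omega> L a)"
proof
  fix \<rho>
  note D = simplicial_complex_onD[OF simplicial_complex_alexander_dual[OF assms]]
  show "to_dual \<omega> L (boundary \<omega> a) \<rho> = coboundary (alexander_dual \<omega> L) (to_dual \<omega> L a) \<rho>"
  proof (cases "\<rho> \<in> alexander_dual \<omega> L")
    case True
    then have sub: "\<rho> \<subseteq> \<omega>" and fin: "finite \<rho>"
      using D(2)[OF True] D(1) finite_subset by auto
    have compl: "\<omega> - (\<omega> - \<rho>) = \<rho>"
      using sub by auto
    have "to_dual \<omega> L (boundary \<omega> a) \<rho> =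
        (\<Sum>k\<in>\<rho>. dual_sign \<omega> \<rho> * (face_sign k (\<omega> - \<rho>) * a (insert k (\<omega> - \<rho>))))"
      using True by (simp add: to_dual_def boundary_def compl sum_distrib_left)
    also have "\<dots> = (\<Sum>k\<in>\<rho>. face_sign k \<rho> * to_dual \<omega> L a (\<rho> - {k}))"
    proof (rule sum.cong[OF refl])
      fix k assume k: "k \<in> \<rho>"
      have "\<rho> - {k} \<in> alexander_dual \<omega> L"
        using D(3)[OF True] by blast
      moreover have "\<omega> - (\<rho> - {k}) = insert k (\<omega> - \<rho>)"
        using k sub by auto
      moreover have "face_sign k \<rho> * dual_sign \<omega> (\<rho> - {k}) = dual_sign \<omega> \<rho> * face_sign k (\<omega> - \<rho>)"
        using face_sign_partition[OF sub, of k] face_sign_square[of k \<rho>]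
        by (simp add: dual_sign_remove[OF fin k] flip: mult.assoc)
      ultimately show "dual_sign \<omega> \<rho> * (face_sign k (\<omega> - \<rho>) * a (insert k (\<omega> - \<rho>))) =
          face_sign k \<rho> * to_dual \<omega> L a (\<rho> - {k})"
        by (simp add: to_dual_def flip: mult.assoc)
    qed
    finally show ?thesis
      using True by (simp add: coboundary_def)
  qed (simp add: to_dual_def coboundary_def)
qed

lemma to_dual_from_dual:
  assumes "f \<in> carrier (supported_functions (faces (alexander_dual \<omega> L) r))"
  shows "to_dual \<omega> L (from_dual \<omega> f) = f"
proof
  fix \<rho>
  show "to_dual \<omega> L (from_dual \<omega> f) \<rho> = f \<rho>"
  proof (cases "\<rho> \<in> alexander_dual \<omega> L")
    case True
    then have "\<omega> - (\<omega> - \<rho>) = \<rho>"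
      by (auto simp: alexander_dual_iff)
    then show ?thesis
      using True by (simp add: to_dual_def from_dual_def dual_sign_square flip: mult.assoc)
  next
    case False
    then show ?thesis
      using assms by (simp add: to_dual_def carrier_supported_functions faces_def)
  qed
qed

lemma to_dual_closed:
  assumes "finite \<omega>" and a: "a \<in> carrier (supported_functions (faces (Pow \<omega>) q))"
  shows "to_dual \<omega> L a \<in> carrier (supported_functions (faces (alexander_dual \<omega> L) (int (card \<omega>) - q)))"
  unfolding carrier_supported_functions
proof (intro allI impI)
  fix \<rho> assume \<rho>: "\<rho> \<notin> faces (alexander_dual \<omega> L) (int (card \<omega>) - q)"
  show "to_dual \<omega> L a \<rho> = 0"
  proof (cases "\<rho> \<in> alexander_dual \<omega> L")
    case True
    then have "\<rho> \<subseteq> \<omega>"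
      by (simp add: alexander_dual_iff)
    then have "int (card (\<omega> - \<rho>)) = int (card \<omega>) - int (card \<rho>)"
      using assms(1) by (simp add: card_Diff_subset card_mono finite_subset of_nat_diff)
    then have "\<omega> - \<rho> \<notin> faces (Pow \<omega>) q"
      using \<rho> True by (auto simp: faces_def)
    then show ?thesis
      using a by (simp add: to_dual_def carrier_supported_functions)
  qed (simp add: to_dual_def)
qed

lemma from_dual_closed:
  assumes "finite \<omega>" and f: "f \<in> carrier (supported_functions (faces M r))"
  shows "from_dual \<omega> f \<in> carrier (supported_functions (faces (Pow \<omega>) (int (card \<omega>) - r)))"
  unfolding carrier_supported_functions
proof (intro allI impI)
  fix \<tau> assume \<tau>: "\<tau> \<notin> faces (Pow \<omega>) (int (card \<omega>) - r)"
  show "from_dual \<omega> f \<tau> = 0"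
  proof (cases "\<tau> \<subseteq> \<omega>")
    case True
    then have "int (card (\<omega> - \<tau>)) = int (card \<omega>) - int (card \<tau>)"
      using assms(1) by (simp add: card_Diff_subset card_mono finite_subset of_nat_diff)
    then have "\<omega> - \<tau> \<notin> faces M r"
      using \<tau> True by (auto simp: faces_def)
    then show ?thesis
      using f by (simp add: from_dual_def carrier_supported_functions)
  qed (simp add: from_dual_def)
qed

text \<open>
  Exactness of the sequence of chains: the kernel of the projection to relative chains consists of the
  chains of \<open>L\<close>.
\<close>
lemma to_dual_eq_zero_iff:
  assumes "simplicial_complex_on \<omega> L" and a: "a \<in> carrier (supported_functions (faces (Pow \<omega>) q))"
  shows "to_dual \<omega> L a = (\<lambda>_. 0) \<longleftrightarrow> a \<in> carrier (supported_functions (faces L q))"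
proof
  assume zero: "to_dual \<omega> L a = (\<lambda>_. 0)"
  show "a \<in> carrier (supported_functions (faces L q))"
    unfolding carrier_supported_functions
  proof (intro allI impI)
    fix \<tau> assume \<tau>: "\<tau> \<notin> faces L q"
    show "a \<tau> = 0"
    proof (cases "\<tau> \<in> faces (Pow \<omega>) q")
      case True
      then have "\<omega> - \<tau> \<in> alexander_dual \<omega> L" and "\<omega> - (\<omega> - \<tau>) = \<tau>"
        using \<tau> by (auto simp: alexander_dual_iff faces_def double_diff)
      then have "dual_sign \<omega> (\<omega> - \<tau>) * a \<tau> = 0"
        using fun_cong[OF zero, of "\<omega> - \<tau>"] by (simp add: to_dual_def)
      then show ?thesis
        using dual_sign_square[of \<omega> "\<omega> - \<tau>"] by auto
    qed (use a in \<open>simp add: carrier_supported_functions\<close>)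
  qed
next
  assume "a \<in> carrier (supported_functions (faces L q))"
  then show "to_dual \<omega> L a = (\<lambda>_. 0)"
    by (auto simp: to_dual_def alexander_dual_iff carrier_supported_functions faces_def)
qed

text \<open>
  Every cochain of \<open>L\<close> is the dual of a chain, \<open>L\<close> being itself an Alexander dual. So the
  composite of two coboundaries vanishes because that of two boundaries does.
\<close>
lemma composable_coboundaries:
  assumes "simplicial_complex_on \<omega> L"
  shows "composable_homs (supported_functions (faces L (q - 1))) (supported_functions (faces L q))
           (supported_functions (faces L (q + 1))) (coboundary L) (coboundary L)"
proof (intro composable_homs.intro composable_homs_axioms.intro comm_group_supported_functions)
  show "coboundary L \<in> hom (supported_functions (faces L (q - 1))) (supported_functions (faces L q))"
    using coboundary_closed[OF assms, of _ "q - 1"] by (intro homI) (simp_all add: coboundary_add)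
  show "coboundary L \<in> hom (supported_functions (faces L q)) (supported_functions (faces L (q + 1)))"
    using coboundary_closed[OF assms, of _ q] by (intro homI) (simp_all add: coboundary_add)
next
  fix f assume f: "f \<in> carrier (supported_functions (faces L (q - 1)))"
  define M where "M = alexander_dual \<omega> L"
  have M: "simplicial_complex_on \<omega> M" and L: "L = alexander_dual \<omega> M"
    using assms by (simp_all add: M_def simplicial_complex_alexander_dual alexander_dual_dual)
  have "coboundary L (coboundary L f) = to_dual \<omega> M (boundary \<omega> (boundary \<omega> (from_dual \<omega> f)))"
    using f to_dual_from_dual[of f \<omega> M] by (simp add: to_dual_boundary[OF M] flip: L)
  also have "\<dots> = (\<lambda>_. 0)"
    by (simp add: boundary_boundary[OF simplicial_complex_onD(1)[OF assms]] to_dual_def fun_eq_iff)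
  finally show "coboundary L (coboundary L f) = \<one>\<^bsub>supported_functions (faces L (q + 1))\<^esub>"
    by simp
qed

lemma cone_chain_closed:
  assumes "finite \<omega>" and a: "a \<in> carrier (supported_functions (faces (Pow \<omega>) q))"
  shows "cone_chain \<omega> a \<in> carrier (supported_functions (faces (Pow \<omega>) (q + 1)))"
  unfolding carrier_supported_functions
proof (intro allI impI)
  fix \<tau> assume \<tau>: "\<tau> \<notin> faces (Pow \<omega>) (q + 1)"
  show "cone_chain \<omega> a \<tau> = 0"
  proof (cases "\<tau> \<subseteq> \<omega> \<and> Min \<omega> \<in> \<tau>")
    case True
    then have "\<tau> - {Min \<omega>} \<notin> faces (Pow \<omega>) q"
      using \<tau> card_Suc_Diff1[of \<tau> "Min \<omega>"] finite_subset[OF _ assms(1), of \<tau>]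
      by (auto simp: faces_def)
    then show ?thesis
      using a by (simp add: cone_chain_def carrier_supported_functions)
  qed (auto simp: cone_chain_def)
qed

text \<open>
  The boundary of the cone over a cycle is the cycle itself, which has no part outside \<open>L\<close>; so the dual of the
  cone is a cocycle. Conversely a cocycle \<open>f\<close> of \<open>L\<degree>\<close> comes from a chain \<open>c\<close> of the full simplex
  whose boundary lies in \<open>L\<close>, and this boundary is the cycle sent to the class of \<open>f\<close>: its cone
  differs from \<open>c\<close> by a boundary. As \<open>\<omega>\<close> is nonempty, there is a vertex to cone with.
\<close>
theorem simplicial_alexander_duality:
  assumes L: "simplicial_complex_on \<omega> L" and "\<omega> \<noteq> {}"
  shows "simplicial_homology \<omega> L q \<cong>
           simplicial_cohomology (alexander_dual \<omega> L) (int (card \<omega>) - q - 1)"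
  unfolding simplicial_homology_def simplicial_cohomology_def
proof (rule homology_at_isoI[OF composable_boundaries[OF L]
        composable_coboundaries[OF simplicial_complex_alexander_dual[OF L]],
        where \<gamma> = "to_dual \<omega> L \<circ> cone_chain \<omega>"])
  let ?M = "alexander_dual \<omega> L" and ?r = "int (card \<omega>) - q - 1"
  have fin: "finite \<omega>"
    using simplicial_complex_onD(1)[OF L] .
  note M = simplicial_complex_alexander_dual[OF L]
  have faces_sub: "a \<in> carrier (supported_functions (faces (Pow \<omega>) p))"
    if "a \<in> carrier (supported_functions (faces L p))" for a p
    using that simplicial_complex_onD(2)[OF L] by (auto simp: carrier_supported_functions faces_def)
  have homotopy: "boundary \<omega> (cone_chain \<omega> a) = (\<lambda>\<tau>. a \<tau> - cone_chain \<omega> (boundary \<omega> a) \<tau>)"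
    if "a \<in> carrier (supported_functions (faces (Pow \<omega>) p))" for a p
    using that by (intro cone_homotopy fin assms(2)) (auto simp: carrier_supported_functions faces_def)
  have closed: "to_dual \<omega> L (cone_chain \<omega> a) \<in> carrier (supported_functions (faces ?M (int (card \<omega>) - p - 1)))"
    if "a \<in> carrier (supported_functions (faces (Pow \<omega>) p))" for a p
    using to_dual_closed[OF fin cone_chain_closed[OF fin that], of L] by (simp add: algebra_simps)
  show "to_dual \<omega> L \<circ> cone_chain \<omega> \<in> hom (supported_functions (faces L q)) (supported_functions (faces ?M ?r))"
    using closed[OF faces_sub, of _ q] by (intro homI) (simp_all add: cone_chain_add to_dual_add)

  fix a assume a: "a \<in> carrier (supported_functions (faces L q))"
    and "boundary \<omega> a = \<one>\<^bsub>supported_functions (faces L (q - 1))\<^esub>"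
  then have cycle: "boundary \<omega> a = (\<lambda>_. 0)"
    by simp
  have bd_cone: "boundary \<omega> (cone_chain \<omega> a) = a"
    using homotopy[OF faces_sub[OF a]] by (simp add: cycle cone_chain_zero)
  show "coboundary ?M ((to_dual \<omega> L \<circ> cone_chain \<omega>) a) = \<one>\<^bsub>supported_functions (faces ?M (?r + 1))\<^esub>"
    using to_dual_eq_zero_iff[OF L faces_sub[OF a]] a
    by (simp add: bd_cone flip: to_dual_boundary[OF L])
  show "(to_dual \<omega> L \<circ> cone_chain \<omega>) a \<in> coboundary ?M ` carrier (supported_functions (faces ?M (?r - 1))) \<longleftrightarrow>
        a \<in> boundary \<omega> ` carrier (supported_functions (faces L (q + 1)))"
  proof
    assume "a \<in> boundary \<omega> ` carrier (supported_functions (faces L (q + 1)))"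
    then obtain b where b: "b \<in> carrier (supported_functions (faces L (q + 1)))" "a = boundary \<omega> b"
      by blast
    \<comment> \<open>The cone over \<open>boundary \<omega> b\<close> is \<open>b\<close>, which has no dual, minus the boundary of \<open>c\<close>.\<close>
    define c where "c = cone_chain \<omega> b"
    have "cone_chain \<omega> a = (\<lambda>\<tau>. b \<tau> - boundary \<omega> c \<tau>)"
      using homotopy[OF faces_sub[OF b(1)]] unfolding b(2) c_def by (simp add: fun_eq_iff)
    then have "to_dual \<omega> L (cone_chain \<omega> a) = (\<lambda>\<tau>. 0 - coboundary ?M (to_dual \<omega> L c) \<tau>)"
      using to_dual_eq_zero_iff[OF L faces_sub[OF b(1)]] b(1)
      by (simp add: to_dual_diff to_dual_boundary[OF L])
    also have "\<dots> = coboundary ?M (\<lambda>\<tau>. - to_dual \<omega> L c \<tau>)"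
      by (auto simp: coboundary_def sum_negf)
    finally have "to_dual \<omega> L (cone_chain \<omega> a) = coboundary ?M (\<lambda>\<tau>. - to_dual \<omega> L c \<tau>)" .
    moreover have "(\<lambda>\<tau>. - to_dual \<omega> L c \<tau>) \<in> carrier (supported_functions (faces ?M (?r - 1)))"
      using closed[OF faces_sub[OF b(1)]] by (simp add: c_def carrier_supported_functions algebra_simps)
    ultimately show "(to_dual \<omega> L \<circ> cone_chain \<omega>) a \<in> coboundary ?M ` carrier (supported_functions (faces ?M (?r - 1)))"
      by simp
  next
    assume "(to_dual \<omega> L \<circ> cone_chain \<omega>) a \<in> coboundary ?M ` carrier (supported_functions (faces ?M (?r - 1)))"
    then obtain g where g: "g \<in> carrier (supported_functions (faces ?M (?r - 1)))"
      and eq: "to_dual \<omega> L (cone_chain \<omega> a) = coboundary ?M g"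
      by auto
    \<comment> \<open>Subtracting a boundary removes the part of the cone outside \<open>L\<close> and keeps its boundary equal to \<open>a\<close>.\<close>
    define e where "e = from_dual \<omega> g"
    define b where "b = (\<lambda>\<tau>. cone_chain \<omega> a \<tau> - boundary \<omega> e \<tau>)"
    have "e \<in> carrier (supported_functions (faces (Pow \<omega>) (q + 2)))"
      using from_dual_closed[OF fin g] by (simp add: e_def algebra_simps)
    moreover have "simplicial_complex_on \<omega> (Pow \<omega>)"
      using fin by (auto simp: simplicial_complex_on_def)
    ultimately have "boundary \<omega> e \<in> carrier (supported_functions (faces (Pow \<omega>) (q + 1)))"
      using boundary_closed[of \<omega> "Pow \<omega>" e "q + 2"] by (simp add: algebra_simps)
    then have b_Pow: "b \<in> carrier (supported_functions (faces (Pow \<omega>) (q + 1)))"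
      using cone_chain_closed[OF fin faces_sub[OF a]] by (simp add: b_def carrier_supported_functions)
    have "to_dual \<omega> L b = (\<lambda>_. 0)"
      using to_dual_from_dual[OF g]
      by (simp add: b_def to_dual_diff eq to_dual_boundary[OF L] e_def)
    then have "b \<in> carrier (supported_functions (faces L (q + 1)))"
      using to_dual_eq_zero_iff[OF L b_Pow] by simp
    moreover have "boundary \<omega> b = a"
      by (simp add: b_def boundary_diff boundary_boundary[OF fin] bd_cone)
    ultimately show "a \<in> boundary \<omega> ` carrier (supported_functions (faces L (q + 1)))"
      by blast
  qed
next
  let ?M = "alexander_dual \<omega> L" and ?r = "int (card \<omega>) - q - 1"
  have fin: "finite \<omega>"
    using simplicial_complex_onD(1)[OF L] .
  fix f assume f: "f \<in> carrier (supported_functions (faces ?M ?r))"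
    and cocycle: "coboundary ?M f = \<one>\<^bsub>supported_functions (faces ?M (?r + 1))\<^esub>"
  define c where "c = from_dual \<omega> f"
  define a where "a = boundary \<omega> c"
  have c: "c \<in> carrier (supported_functions (faces (Pow \<omega>) (q + 1)))"
    using from_dual_closed[OF fin f] by (simp add: c_def algebra_simps)
  have "simplicial_complex_on \<omega> (Pow \<omega>)"
    using fin by (auto simp: simplicial_complex_on_def)
  then have a_Pow: "a \<in> carrier (supported_functions (faces (Pow \<omega>) q))"
    using boundary_closed[OF _ c] by (simp add: a_def)
  have "to_dual \<omega> L a = (\<lambda>_. 0)"
    using cocycle to_dual_from_dual[OF f] by (simp add: a_def to_dual_boundary[OF L] c_def)
  then have a: "a \<in> carrier (supported_functions (faces L q))"
    using to_dual_eq_zero_iff[OF L a_Pow] by simp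
  have "boundary \<omega> (cone_chain \<omega> c) = (\<lambda>\<tau>. c \<tau> - cone_chain \<omega> a \<tau>)"
    unfolding a_def using c
    by (intro cone_homotopy fin assms(2)) (auto simp: carrier_supported_functions faces_def)
  then have "c = (\<lambda>\<tau>. boundary \<omega> (cone_chain \<omega> c) \<tau> + cone_chain \<omega> a \<tau>)"
    by (simp add: fun_eq_iff)
  then have "to_dual \<omega> L c = to_dual \<omega> L (\<lambda>\<tau>. boundary \<omega> (cone_chain \<omega> c) \<tau> + cone_chain \<omega> a \<tau>)"
    by simp
  then have "f = (\<lambda>\<tau>. coboundary ?M (to_dual \<omega> L (cone_chain \<omega> c)) \<tau> + to_dual \<omega> L (cone_chain \<omega> a) \<tau>)"
    using to_dual_from_dual[OF f] by (simp add: c_def to_dual_add to_dual_boundary[OF L])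
  moreover have "to_dual \<omega> L (cone_chain \<omega> c) \<in> carrier (supported_functions (faces ?M (?r - 1)))"
    using to_dual_closed[OF fin cone_chain_closed[OF fin c], of L] by (simp add: algebra_simps)
  moreover have "boundary \<omega> a = (\<lambda>_. 0)"
    by (simp add: a_def boundary_boundary[OF fin])
  ultimately show "\<exists>a\<in>carrier (supported_functions (faces L q)).
      boundary \<omega> a = \<one>\<^bsub>supported_functions (faces L (q - 1))\<^esub> \<and>
      (\<exists>g\<in>carrier (supported_functions (faces ?M (?r - 1))).
         f = coboundary ?M g \<otimes>\<^bsub>supported_functions (faces ?M ?r)\<^esub> (to_dual \<omega> L \<circ> cone_chain \<omega>) a)"
    using a by (intro bexI[of _ a] conjI bexI[of _ "to_dual \<omega> L (cone_chain \<omega> c)"]) simp_all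
qed


section \<open>Coordinates for local chains and cochains\<close>

definition coordinates :: "(nat set \<Rightarrow> 'a) \<Rightarrow> nat set set \<Rightarrow> ('a \<Rightarrow>\<^sub>0 int) \<Rightarrow> nat set \<Rightarrow> int" where
  "coordinates w P c \<tau> = (if \<tau> \<in> P then Poly_Mapping.lookup c (w \<tau>) else 0)"

definition dual_coordinates ::
    "(nat set \<Rightarrow> 'a) \<Rightarrow> nat set set \<Rightarrow> (('a \<Rightarrow>\<^sub>0 int) \<Rightarrow> int) \<Rightarrow> nat set \<Rightarrow> int" where
  "dual_coordinates w P f \<tau> = (if \<tau> \<in> P then f (frag_of (w \<tau>)) else 0)"

lemma lookup_sum_frag:
  "Poly_Mapping.lookup (\<Sum>k\<in>A. frag_cmul (s k) (frag_of (x k))) y = (\<Sum>k\<in>A. if x k = y then s k else 0)"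
  by (auto simp: lookup_sum intro!: sum.cong)

lemma coordinates_iso:
  assumes "finite P" "inj_on w P"
  shows "coordinates w P \<in> iso (free_Abelian_group (w ` P)) (supported_functions P)"
  unfolding iso_iff
proof (intro conjI)
  show "coordinates w P \<in> hom (free_Abelian_group (w ` P)) (supported_functions P)"
    by (rule homI) (auto simp: coordinates_def carrier_supported_functions lookup_add)
  show "inj_on (coordinates w P) (carrier (free_Abelian_group (w ` P)))"
  proof (rule inj_onI, rule poly_mapping_eqI)
    fix c d k
    assume cd: "c \<in> carrier (free_Abelian_group (w ` P))" "d \<in> carrier (free_Abelian_group (w ` P))"
      and eq: "coordinates w P c = coordinates w P d"
    show "Poly_Mapping.lookup c k = Poly_Mapping.lookup d k"
    proof (cases "k \<in> w ` P")
      case True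
      then obtain \<tau> where "\<tau> \<in> P" "k = w \<tau>"
        by blast
      then show ?thesis
        using fun_cong[OF eq, of \<tau>] by (simp add: coordinates_def)
    next
      case False
      then have "k \<notin> Poly_Mapping.keys c" "k \<notin> Poly_Mapping.keys d"
        using cd by auto
      then show ?thesis
        by (simp add: in_keys_iff)
    qed
  qed
  show "coordinates w P ` carrier (free_Abelian_group (w ` P)) = carrier (supported_functions P)"
  proof (intro Set.equalityI subsetI)
    fix a assume a: "a \<in> carrier (supported_functions P)"
    define c where "c = (\<Sum>\<tau>\<in>P. frag_cmul (a \<tau>) (frag_of (w \<tau>)))"
    have "Poly_Mapping.keys c \<subseteq> (\<Union>\<tau>\<in>P. Poly_Mapping.keys (frag_cmul (a \<tau>) (frag_of (w \<tau>))))"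
      unfolding c_def by (rule keys_sum)
    also have "\<dots> \<subseteq> w ` P"
      using keys_cmul by (fastforce simp: keys_frag_of)
    finally have "c \<in> carrier (free_Abelian_group (w ` P))"
      by simp
    moreover have "coordinates w P c = a"
    proof
      fix \<tau>
      show "coordinates w P c \<tau> = a \<tau>"
      proof (cases "\<tau> \<in> P")
        case True
        have "Poly_Mapping.lookup c (w \<tau>) = (\<Sum>\<rho>\<in>P. if \<rho> = \<tau> then a \<rho> else 0)"
          unfolding c_def lookup_sum_frag using assms(2) True
          by (intro sum.cong) (auto simp: inj_on_eq_iff)
        then show ?thesis
          using True assms(1) by (simp add: coordinates_def sum.delta)
      qed (use a in \<open>simp add: coordinates_def carrier_supported_functions\<close>)
    qed
    ultimately show "a \<in> coordinates w P ` carrier (free_Abelian_group (w ` P))"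
      by blast
  qed (auto simp: coordinates_def carrier_supported_functions)
qed

lemma carrier_dual_group: "f \<in> carrier (dual_group G) \<longleftrightarrow> f \<in> hom G integer_group \<and> f \<in> extensional (carrier G)"
  by (simp add: dual_group_def)

lemma mult_dual_group: "f \<otimes>\<^bsub>dual_group G\<^esub> g = (\<lambda>x\<in>carrier G. f x + g x)"
  by (simp add: dual_group_def)

lemma one_dual_group: "\<one>\<^bsub>dual_group G\<^esub> = (\<lambda>x\<in>carrier G. 0)"
  by (simp add: dual_group_def)

lemma comm_group_dual_group:
  assumes "group G"
  shows "comm_group (dual_group G)"
proof (rule comm_groupI)
  interpret G: group G by fact
  fix f assume f: "f \<in> carrier (dual_group G)"
  then show "\<one>\<^bsub>dual_group G\<^esub> \<otimes>\<^bsub>dual_group G\<^esub> f = f"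
    unfolding mult_dual_group one_dual_group
    by (intro extensionalityI[where A = "carrier G"]) (auto simp: carrier_dual_group)
  have "(\<lambda>x\<in>carrier G. - f x) \<in> carrier (dual_group G)"
    using f by (auto simp: carrier_dual_group hom_def)
  then show "\<exists>g\<in>carrier (dual_group G). g \<otimes>\<^bsub>dual_group G\<^esub> f = \<one>\<^bsub>dual_group G\<^esub>"
    by (rule rev_bexI) (auto simp: mult_dual_group one_dual_group fun_eq_iff)
next
  interpret G: group G by fact
  fix f g assume "f \<in> carrier (dual_group G)" "g \<in> carrier (dual_group G)"
  then show "f \<otimes>\<^bsub>dual_group G\<^esub> g \<in> carrier (dual_group G)"
    unfolding mult_dual_group by (auto simp: carrier_dual_group hom_def)
next
  interpret G: group G by fact
  show "\<one>\<^bsub>dual_group G\<^esub> \<in> carrier (dual_group G)"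
    unfolding one_dual_group by (auto simp: carrier_dual_group hom_def)
qed (auto simp: mult_dual_group algebra_simps)

lemma integer_functional:
  assumes "f \<in> hom (free_Abelian_group S) integer_group"
  shows integer_functional_zero: "f 0 = 0"
    and integer_functional_add:
      "Poly_Mapping.keys a \<subseteq> S \<Longrightarrow> Poly_Mapping.keys b \<subseteq> S \<Longrightarrow> f (a + b) = f a + f b"
    and integer_functional_minus: "Poly_Mapping.keys a \<subseteq> S \<Longrightarrow> f (- a) = - f a"
    and integer_functional_diff:
      "Poly_Mapping.keys a \<subseteq> S \<Longrightarrow> Poly_Mapping.keys b \<subseteq> S \<Longrightarrow> f (a - b) = f a - f b"
proof -
  show add: "f (a + b) = f a + f b" if "Poly_Mapping.keys a \<subseteq> S" "Poly_Mapping.keys b \<subseteq> S" for a b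
    using hom_mult[OF assms, of a b] that by simp
  show zero: "f 0 = 0"
    using add[of 0 0] by simp
  show minus: "f (- a) = - f a" if "Poly_Mapping.keys a \<subseteq> S" for a
    using add[of a "- a"] that zero by simp
  show "f (a - b) = f a - f b" if "Poly_Mapping.keys a \<subseteq> S" "Poly_Mapping.keys b \<subseteq> S"
    using add[of a "- b"] minus[of b] that by simp
qed

text \<open>
  A homomorphism from a free abelian group is the same as a function on the basis; extensionality of the elements
  of the dual group makes this correspondence injective.
\<close>
lemma dual_coordinates_iso:
  assumes "inj_on w P"
  shows "dual_coordinates w P \<in> iso (dual_group (free_Abelian_group (w ` P))) (supported_functions P)"
  unfolding iso_iff
proof (intro conjI)
  let ?F = "free_Abelian_group (w ` P)"
  have gen: "frag_of (w \<tau>) \<in> carrier ?F" if "\<tau> \<in> P" for \<tau>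
    using that by (simp add: keys_frag_of)
  show "dual_coordinates w P \<in> hom (dual_group ?F) (supported_functions P)"
    by (rule homI)
      (auto simp: dual_coordinates_def carrier_supported_functions mult_dual_group fun_eq_iff keys_frag_of)
  show "inj_on (dual_coordinates w P) (carrier (dual_group ?F))"
  proof (rule inj_onI)
    fix f g assume f: "f \<in> carrier (dual_group ?F)" and g: "g \<in> carrier (dual_group ?F)"
      and eq: "dual_coordinates w P f = dual_coordinates w P g"
    have hom: "f \<in> hom ?F integer_group" "g \<in> hom ?F integer_group"
      using f g by (auto simp: carrier_dual_group)
    have "f c = g c" if "Poly_Mapping.keys c \<subseteq> w ` P" for c
      using that
    proof (induction rule: free_Abelian_group_induct[consumes 1, case_names zero diff gen])
      case zero
      show ?case
        using hom by (simp add: integer_functional_zero)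
    next
      case (diff x y)
      then show ?case
        using hom by (simp add: integer_functional_diff)
    next
      case (gen a)
      then obtain \<tau> where "\<tau> \<in> P" "a = w \<tau>"
        by blast
      then show ?case
        using fun_cong[OF eq, of \<tau>] by (simp add: dual_coordinates_def)
    qed
    then show "f = g"
      using f g by (intro extensionalityI[where A = "carrier ?F"]) (auto simp: carrier_dual_group)
  qed
  show "dual_coordinates w P ` carrier (dual_group ?F) = carrier (supported_functions P)"
  proof (intro Set.equalityI subsetI)
    fix a assume a: "a \<in> carrier (supported_functions P)"
    interpret Z: comm_group integer_group by (rule abelian_integer_group)
    obtain h where h: "h \<in> hom ?F integer_group"
      and h_gen: "\<And>x. x \<in> w ` P \<Longrightarrow> h (frag_of x) = a (the_inv_into P w x)"
      using Z.free_Abelian_group_universal[of "\<lambda>x. a (the_inv_into P w x)" "w ` P"] by auto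
    have "restrict h (carrier ?F) \<in> carrier (dual_group ?F)"
      unfolding carrier_dual_group by (intro conjI group.hom_restrict[OF group_free_Abelian_group h]) auto
    moreover have "dual_coordinates w P (restrict h (carrier ?F)) = a"
    proof
      fix \<tau>
      show "dual_coordinates w P (restrict h (carrier ?F)) \<tau> = a \<tau>"
        using a gen[of \<tau>] h_gen[of "w \<tau>"] the_inv_into_f_f[OF assms, of \<tau>]
        by (auto simp: dual_coordinates_def carrier_supported_functions)
    qed
    ultimately show "a \<in> dual_coordinates w P ` carrier (dual_group ?F)"
      by blast
  qed (auto simp: dual_coordinates_def carrier_supported_functions)
qed

text \<open>
  The basis tensor with index sets \<open>\<sigma>\<close> and \<open>\<omega>\<close> that corresponds to the face \<open>\<tau> \<subseteq> \<omega>\<close>.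
\<close>
definition local_tensor :: "nat \<Rightarrow> nat set \<Rightarrow> nat set \<Rightarrow> nat set \<Rightarrow> tensor" where
  "local_tensor m \<sigma> \<omega> \<tau> =
     (\<lambda>k\<in>{1..m}. if k \<in> \<sigma> then GE else if k \<in> \<tau> then GNbar else if k \<in> \<omega> then GN else GI)"

lemma simplicial_complex_local_complex:
  assumes "simplicial_complex_on S K" "\<omega> \<subseteq> S"
  shows "simplicial_complex_on \<omega> (local_complex K \<sigma> \<omega>)"
proof -
  note K = simplicial_complex_onD[OF assms(1)]
  have "\<tau>' \<in> local_complex K \<sigma> \<omega>" if "\<tau> \<in> local_complex K \<sigma> \<omega>" "\<tau>' \<subseteq> \<tau>" for \<tau> \<tau>'
    using that K(3)[of "\<tau> \<union> \<sigma>" "\<tau>' \<union> \<sigma>"] by (auto simp: local_complex_def split: if_splits)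
  moreover have "local_complex K \<sigma> \<omega> \<subseteq> Pow \<omega>"
    by (auto simp: local_complex_def)
  ultimately show ?thesis
    using finite_subset[OF assms(2) K(1)] unfolding simplicial_complex_on_def by blast
qed

text \<open>
  In a complex \<open>\<tau> \<union> \<sigma> \<in> K\<close> already forces \<open>\<sigma> \<in> K\<close>, so the case distinction in the definition of the
  local complex disappears.
\<close>
lemma local_complex_iff:
  assumes "simplicial_complex_on S K"
  shows "\<tau> \<in> local_complex K \<sigma> \<omega> \<longleftrightarrow> \<tau> \<subseteq> \<omega> \<and> \<tau> \<union> \<sigma> \<in> K"
  using simplicial_complex_onD(3)[OF assms, of "\<tau> \<union> \<sigma>" \<sigma>] by (auto simp: local_complex_def)

lemma inj_on_local_tensor:
  assumes "(\<sigma>, \<omega>) \<in> index_pairs m"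
  shows "inj_on (local_tensor m \<sigma> \<omega>) (Pow \<omega>)"
proof (rule inj_onI)
  fix \<tau> \<tau>' assume \<tau>: "\<tau> \<in> Pow \<omega>" "\<tau>' \<in> Pow \<omega>" and eq: "local_tensor m \<sigma> \<omega> \<tau> = local_tensor m \<sigma> \<omega> \<tau>'"
  have recover: "k \<in> \<rho> \<longleftrightarrow> k \<in> \<omega> \<and> local_tensor m \<sigma> \<omega> \<rho> k = GNbar" if "\<rho> \<subseteq> \<omega>" for \<rho> k
    using that assms by (auto simp: local_tensor_def index_pairs_def)
  show "\<tau> = \<tau>'"
    using recover[of \<tau>] recover[of \<tau>'] \<tau> eq by auto
qed

lemma gen_deg_local_tensor:
  assumes "(\<sigma>, \<omega>) \<in> index_pairs m" "\<tau> \<subseteq> \<omega>"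
  shows "k \<in> {1..m} \<Longrightarrow> gen_deg (local_tensor m \<sigma> \<omega> \<tau> k) = (if k \<in> \<tau> then 1 else 0)"
  using assms by (auto simp: local_tensor_def index_pairs_def)

lemma tensor_deg_local_tensor:
  assumes "(\<sigma>, \<omega>) \<in> index_pairs m" "\<tau> \<subseteq> \<omega>"
  shows "tensor_deg m (local_tensor m \<sigma> \<omega> \<tau>) = card \<tau>"
proof -
  have "tensor_deg m (local_tensor m \<sigma> \<omega> \<tau>) = (\<Sum>k\<in>{1..m}. if k \<in> \<tau> then 1 else 0)"
    unfolding tensor_deg_def by (intro sum.cong refl gen_deg_local_tensor[OF assms])
  also have "\<dots> = card ({1..m} \<inter> \<tau>)"
    by (simp flip: sum.inter_restrict)
  also have "{1..m} \<inter> \<tau> = \<tau>"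
    using assms by (auto simp: index_pairs_def)
  finally show ?thesis .
qed

text \<open>
  The factors of degree 1 before position \<open>k\<close> sit at the elements of \<open>\<tau>\<close> below \<open>k\<close>, so the Koszul sign
  is the simplicial one.
\<close>
lemma tensor_diff_local_tensor:
  assumes "(\<sigma>, \<omega>) \<in> index_pairs m" "\<tau> \<subseteq> \<omega>"
  shows "tensor_diff m (frag_of (local_tensor m \<sigma> \<omega> \<tau>)) =
           (\<Sum>k\<in>\<tau>. frag_cmul (face_sign k \<tau>) (frag_of (local_tensor m \<sigma> \<omega> (\<tau> - {k}))))"
proof -
  let ?w = "local_tensor m \<sigma> \<omega>"
  have \<tau>: "\<tau> \<subseteq> {1..m}" "\<tau> \<inter> \<sigma> = {}"
    using assms by (auto simp: index_pairs_def)
  have sign: "(\<Sum>j\<in>{1..<k}. gen_deg (?w \<tau> j)) = card (\<tau> \<inter> {..<k})" if "k \<in> {1..m}" for k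
  proof -
    have "(\<Sum>j\<in>{1..<k}. gen_deg (?w \<tau> j)) = (\<Sum>j\<in>{1..<k}. if j \<in> \<tau> then 1 else 0)"
      using that by (intro sum.cong refl gen_deg_local_tensor[OF assms]) auto
    also have "\<dots> = card ({1..<k} \<inter> \<tau>)"
      by (simp flip: sum.inter_restrict)
    also have "{1..<k} \<inter> \<tau> = \<tau> \<inter> {..<k}"
      using \<tau>(1) by auto
    finally show ?thesis .
  qed
  have "tensor_diff m (frag_of (?w \<tau>)) =
      (\<Sum>k\<in>{1..m}. frag_cmul (face_sign k \<tau>)
         (frag_extend (\<lambda>x. frag_of ((?w \<tau>)(k := x))) (gen_diff (?w \<tau> k))))"
    unfolding tensor_diff_def frag_extend_of tensor_diff_basis_def
    by (intro sum.cong refl) (simp only: sign face_sign_def)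
  also have "\<dots> = (\<Sum>k\<in>\<tau>. frag_cmul (face_sign k \<tau>)
         (frag_extend (\<lambda>x. frag_of ((?w \<tau>)(k := x))) (gen_diff (?w \<tau> k))))"
    using \<tau>(1) by (intro sum.mono_neutral_right) (auto simp: local_tensor_def)
  also have "\<dots> = (\<Sum>k\<in>\<tau>. frag_cmul (face_sign k \<tau>) (frag_of (?w (\<tau> - {k}))))"
  proof (rule sum.cong[OF refl])
    fix k assume k: "k \<in> \<tau>"
    then have "?w \<tau> k = GNbar"
      using \<tau> by (auto simp: local_tensor_def)
    moreover have "(?w \<tau>)(k := GN) = ?w (\<tau> - {k})"
      using k \<tau> assms(2) by (auto simp: local_tensor_def fun_eq_iff)
    ultimately show "frag_cmul (face_sign k \<tau>)
        (frag_extend (\<lambda>x. frag_of ((?w \<tau>)(k := x))) (gen_diff (?w \<tau> k))) =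
        frag_cmul (face_sign k \<tau>) (frag_of (?w (\<tau> - {k})))"
      by simp
  qed
  finally show ?thesis .
qed

text \<open>
  The factors e and n-bar are available only at the vertices of a simplex of \<open>K\<close>. So a tensor with these
  factors exactly on \<open>\<sigma>\<close> and \<open>\<tau>\<close> occurs iff \<open>\<tau> \<union> \<sigma>\<close> is contained in a simplex, hence is one.
\<close>
lemma local_basis_of_degree:
  assumes "simplicial_complex_on {1..m} K" "(\<sigma>, \<omega>) \<in> index_pairs m"
  shows "{w \<in> local_basis m K \<sigma> \<omega>. int (tensor_deg m w) = q} =
           local_tensor m \<sigma> \<omega> ` faces (local_complex K \<sigma> \<omega>) q"
proof (intro Set.equalityI subsetI)
  fix w assume "w \<in> local_tensor m \<sigma> \<omega> ` faces (local_complex K \<sigma> \<omega>) q"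
  then obtain \<tau> where w: "w = local_tensor m \<sigma> \<omega> \<tau>" and \<tau>: "\<tau> \<subseteq> \<omega>" "\<tau> \<union> \<sigma> \<in> K" "int (card \<tau>) = q"
    by (auto simp: faces_def local_complex_iff[OF assms(1)])
  have "w \<in> (\<Pi>\<^sub>E k\<in>{1..m}. if k \<in> \<tau> \<union> \<sigma> then T_basis else S_basis)"
    by (auto simp: w local_tensor_def T_basis_def S_basis_def PiE_iff)
  then have "w \<in> T_complex_basis m K"
    using \<tau>(2) unfolding T_complex_basis_def by blast
  moreover have "{k \<in> {1..m}. gen_idx (w k) = IE} = \<sigma>" "{k \<in> {1..m}. gen_idx (w k) = IN} = \<omega>"
    using assms(2) \<tau>(1) by (auto simp: w local_tensor_def index_pairs_def)
  ultimately show "w \<in> {w \<in> local_basis m K \<sigma> \<omega>. int (tensor_deg m w) = q}"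
    using \<tau>(3) by (simp add: local_basis_def w tensor_deg_local_tensor[OF assms(2) \<tau>(1)])
next
  note K = simplicial_complex_onD[OF assms(1)]
  fix w assume w: "w \<in> {w \<in> local_basis m K \<sigma> \<omega>. int (tensor_deg m w) = q}"
  define \<tau> where "\<tau> = {k \<in> {1..m}. w k = GNbar}"
  have \<sigma>: "{k \<in> {1..m}. gen_idx (w k) = IE} = \<sigma>" and \<omega>: "{k \<in> {1..m}. gen_idx (w k) = IN} = \<omega>"
    using w by (auto simp: local_basis_def)
  obtain \<rho> where \<rho>: "\<rho> \<in> K" and w\<rho>: "w \<in> (\<Pi>\<^sub>E k\<in>{1..m}. if k \<in> \<rho> then T_basis else S_basis)"
    using w by (auto simp: local_basis_def T_complex_basis_def)
  have GE: "w k = GE \<longleftrightarrow> k \<in> \<sigma>" and GI: "w k = GI \<longleftrightarrow> k \<notin> \<sigma> \<and> k \<notin> \<omega>" if "k \<in> {1..m}" for k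
    using that by (cases "w k"; auto simp flip: \<sigma> \<omega>)+
  have "\<tau> \<union> \<sigma> \<subseteq> \<rho>"
  proof
    fix k assume k: "k \<in> \<tau> \<union> \<sigma>"
    then have "k \<in> {1..m}" "w k \<notin> S_basis"
      using GE[of k] \<sigma> by (auto simp: \<tau>_def S_basis_def)
    then show "k \<in> \<rho>"
      using PiE_mem[OF w\<rho>, of k] by (auto split: if_splits)
  qed
  then have "\<tau> \<union> \<sigma> \<in> K"
    using K(3)[OF \<rho>] by blast
  moreover have \<tau>\<omega>: "\<tau> \<subseteq> \<omega>"
    by (auto simp: \<tau>_def simp flip: \<omega>)
  moreover have eq: "w = local_tensor m \<sigma> \<omega> \<tau>"
  proof
    fix k
    show "w k = local_tensor m \<sigma> \<omega> \<tau> k"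
    proof (cases "k \<in> {1..m}")
      case True
      then show ?thesis
        using GE[OF True] GI[OF True] by (cases "w k") (auto simp: local_tensor_def \<tau>_def)
    next
      case False
      then show ?thesis
        using PiE_arb[OF w\<rho> False] by (simp only: local_tensor_def restrict_apply if_False)
    qed
  qed
  moreover have "int (card \<tau>) = q"
    using w tensor_deg_local_tensor[OF assms(2) \<tau>\<omega>] by (simp flip: eq)
  ultimately show "w \<in> local_tensor m \<sigma> \<omega> ` faces (local_complex K \<sigma> \<omega>) q"
    by (auto simp: faces_def local_complex_iff[OF assms(1)])
qed

lemma tensor_diff_diff: "tensor_diff m (x - y) = tensor_diff m x - tensor_diff m y"
  by (simp add: tensor_diff_def frag_extend_diff)

locale indexed_complex =
  fixes m :: nat and K :: "nat set set" and \<sigma> \<omega> :: "nat set"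
  assumes K: "simplicial_complex_on {1..m} K" and \<sigma>\<omega>: "(\<sigma>, \<omega>) \<in> index_pairs m"
begin

abbreviation w where "w \<equiv> local_tensor m \<sigma> \<omega>"
abbreviation L where "L \<equiv> local_complex K \<sigma> \<omega>"

lemma local_complex_complex: "simplicial_complex_on \<omega> L"
  using simplicial_complex_local_complex[OF K] \<sigma>\<omega> by (auto simp: index_pairs_def)

lemma local_chain_eq: "local_chain m K \<sigma> \<omega> q = free_Abelian_group (w ` faces L q)"
  unfolding local_chain_def local_basis_of_degree[OF K \<sigma>\<omega>] ..

lemma faces_subset: "faces L q \<subseteq> Pow \<omega>"
  by (auto simp: faces_def local_complex_def split: if_splits)

lemma inj_on_faces: "inj_on w (faces L q)"
  by (rule inj_on_subset[OF inj_on_local_tensor[OF \<sigma>\<omega>] faces_subset])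

lemma finite_faces: "finite (faces L q)"
  using finite_subset[OF faces_subset] simplicial_complex_onD(1)[OF local_complex_complex] by simp

lemma face_of_face:
  assumes "\<rho> \<in> faces L q" "k \<in> \<rho>"
  shows "\<rho> - {k} \<in> faces L (q - 1)"
proof -
  note L = simplicial_complex_onD[OF local_complex_complex]
  have "\<rho> \<in> L" and "int (card \<rho>) = q"
    using assms(1) by (auto simp: faces_def)
  moreover have "finite \<rho>"
    using L(2)[OF \<open>\<rho> \<in> L\<close>] L(1) finite_subset by blast
  ultimately show ?thesis
    using L(3)[of \<rho> "\<rho> - {k}"] card_Suc_Diff1[of \<rho> k] assms(2) by (force simp: faces_def)
qed

lemma tensor_diff_face_closed:
  assumes "\<rho> \<in> faces L q"
  shows "tensor_diff m (frag_of (w \<rho>)) \<in> carrier (free_Abelian_group (w ` faces L (q - 1)))"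
proof -
  have "\<rho> \<subseteq> \<omega>"
    using assms faces_subset by blast
  have "frag_cmul (face_sign k \<rho>) (frag_of (w (\<rho> - {k}))) \<in> carrier (free_Abelian_group (w ` faces L (q - 1)))"
    if "k \<in> \<rho>" for k
    using face_of_face[OF assms that] keys_cmul[of "face_sign k \<rho>" "frag_of (w (\<rho> - {k}))"]
    unfolding carrier_free_Abelian_group_iff keys_frag_of by blast
  then show ?thesis
    unfolding tensor_diff_local_tensor[OF \<sigma>\<omega> \<open>\<rho> \<subseteq> \<omega>\<close>]
    by (rule sum_closed_free_Abelian_group)
qed

lemma tensor_diff_closed:
  assumes "c \<in> carrier (free_Abelian_group (w ` faces L q))"
  shows "tensor_diff m c \<in> carrier (free_Abelian_group (w ` faces L (q - 1)))"
proof -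
  have "Poly_Mapping.keys (tensor_diff m c) \<subseteq>
      (\<Union>x\<in>Poly_Mapping.keys c. Poly_Mapping.keys (tensor_diff_basis m x))"
    unfolding tensor_diff_def by (rule keys_frag_extend)
  also have "\<dots> \<subseteq> w ` faces L (q - 1)"
    using assms tensor_diff_face_closed unfolding carrier_free_Abelian_group_iff tensor_diff_def
    by fastforce
  finally show ?thesis
    by simp
qed

text \<open>
  It is enough to compare both sides on a basis tensor. There the tensor differential runs over the
  vertices deleted from \<open>\<rho>\<close> and the boundary over the vertices added to \<open>\<tau>\<close>; both sums reduce to the
  vertex \<open>k\<close> with \<open>\<rho> = insert k \<tau>\<close>, if there is one.
\<close>
lemma coordinates_tensor_diff:
  assumes "c \<in> carrier (free_Abelian_group (w ` faces L q))"
  shows "coordinates w (faces L (q - 1)) (tensor_diff m c) = boundary \<omega> (coordinates w (faces L q) c)"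
proof -
  have "Poly_Mapping.keys c \<subseteq> w ` faces L q"
    using assms by simp
  then show ?thesis
  proof (induction rule: free_Abelian_group_induct[consumes 1, case_names zero diff gen])
    case zero
    show ?case
    proof -
      have "coordinates w P 0 = (\<lambda>_. 0)" for P
        by (auto simp: coordinates_def)
      then show ?thesis
        by (simp add: tensor_diff_def boundary_zero)
    qed
  next
    case (diff x y)
    have coord_diff: "coordinates w P (x - y) = (\<lambda>\<tau>. coordinates w P x \<tau> - coordinates w P y \<tau>)" for P x y
      by (auto simp: coordinates_def lookup_minus)
    show ?case
      by (simp add: tensor_diff_diff coord_diff boundary_diff diff)
  next
    case (gen a)
    then obtain \<rho> where a: "a = w \<rho>" and \<rho>: "\<rho> \<in> faces L q"
      by blast
    have sub: "\<rho> \<subseteq> \<omega>"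
      using \<rho> faces_subset by blast
    have fin: "finite \<omega>"
      using simplicial_complex_onD(1)[OF local_complex_complex] .
    have coord_\<rho>: "coordinates w (faces L q) (frag_of (w \<rho>)) \<tau> = (if \<tau> = \<rho> then 1 else 0)" for \<tau>
      using \<rho> inj_on_faces[of q] by (auto simp: coordinates_def inj_on_eq_iff)
    show ?case
    proof
      fix \<tau>
      show "coordinates w (faces L (q - 1)) (tensor_diff m (frag_of a)) \<tau> =
          boundary \<omega> (coordinates w (faces L q) (frag_of a)) \<tau>"
      proof (cases "\<tau> \<in> faces L (q - 1)")
        case True
        then have \<tau>: "\<tau> \<subseteq> \<omega>"
          using faces_subset by blast
        have "coordinates w (faces L (q - 1)) (tensor_diff m (frag_of a)) \<tau> =
            (\<Sum>k\<in>\<rho>. if w (\<rho> - {k}) = w \<tau> then face_sign k \<rho> else 0)"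
          using True by (simp add: coordinates_def a tensor_diff_local_tensor[OF \<sigma>\<omega> sub] lookup_sum_frag)
        also have "\<dots> = (\<Sum>k\<in>\<rho>. if \<rho> - {k} = \<tau> then face_sign k \<tau> else 0)"
        proof (rule sum.cong[OF refl])
          fix k assume "k \<in> \<rho>"
          then have "w (\<rho> - {k}) = w \<tau> \<longleftrightarrow> \<rho> - {k} = \<tau>"
            using inj_on_eq_iff[OF inj_on_faces face_of_face[OF \<rho>] True] by simp
          then show "(if w (\<rho> - {k}) = w \<tau> then face_sign k \<rho> else 0) =
              (if \<rho> - {k} = \<tau> then face_sign k \<tau> else 0)"
            by auto
        qed
        also have "\<dots> = (\<Sum>k\<in>{k \<in> \<rho>. \<rho> - {k} = \<tau>}. face_sign k \<tau>)"
          using finite_subset[OF sub fin] by (intro sum.inter_filter[symmetric])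
        also have "{k \<in> \<rho>. \<rho> - {k} = \<tau>} = {k \<in> \<omega> - \<tau>. insert k \<tau> = \<rho>}"
          using sub by auto
        also have "(\<Sum>k\<in>{k \<in> \<omega> - \<tau>. insert k \<tau> = \<rho>}. face_sign k \<tau>) =
            (\<Sum>k\<in>\<omega> - \<tau>. if insert k \<tau> = \<rho> then face_sign k \<tau> else 0)"
          using fin by (intro sum.inter_filter) simp
        also have "\<dots> = boundary \<omega> (coordinates w (faces L q) (frag_of a)) \<tau>"
          using \<tau> by (auto simp: boundary_def a coord_\<rho> intro!: sum.cong)
        finally show ?thesis .
      next
        case False
        have "coordinates w (faces L q) (frag_of a) \<in> carrier (supported_functions (faces L q))"
          by (simp add: coordinates_def carrier_supported_functions)
        from boundary_closed[OF local_complex_complex this] False show ?thesis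
          by (simp add: coordinates_def carrier_supported_functions)
      qed
    qed
  qed
qed

lemma group_local_homology: "group (local_homology m K \<sigma> \<omega> q)"
  and local_homology_iso_simplicial: "local_homology m K \<sigma> \<omega> q \<cong> simplicial_homology \<omega> L q"
proof -
  let ?C = "local_chain m K \<sigma> \<omega>"
  have comm: "comm_group (?C p)" for p
    unfolding local_chain_def by (rule abelian_free_Abelian_group)
  have iso: "coordinates w (faces L p) \<in> iso (?C p) (supported_functions (faces L p))" for p
    unfolding local_chain_eq by (rule coordinates_iso[OF finite_faces inj_on_faces])
  have closed: "tensor_diff m \<in> carrier (?C (p + 1)) \<rightarrow> carrier (?C p)"
    and chain_map: "c \<in> carrier (?C (p + 1)) \<Longrightarrow> coordinates w (faces L p) (tensor_diff m c) =
      boundary \<omega> (coordinates w (faces L (p + 1)) c)" for p c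
    using tensor_diff_closed[of _ "p + 1"] coordinates_tensor_diff[of _ "p + 1"]
    unfolding local_chain_eq by simp_all
  have closed': "tensor_diff m \<in> carrier (?C q) \<rightarrow> carrier (?C (q - 1))"
    using closed[of "q - 1"] by simp
  have chain_map': "coordinates w (faces L (q - 1)) (tensor_diff m c) =
      boundary \<omega> (coordinates w (faces L q) c)" if "c \<in> carrier (?C q)" for c
    using chain_map[of c "q - 1"] that by simp
  note * = composable_homs_transfer[OF composable_boundaries[OF local_complex_complex] comm comm comm
      iso iso iso, OF closed closed' chain_map chain_map']
  show "group (local_homology m K \<sigma> \<omega> q)"
    unfolding local_homology_def by (rule composable_homs.group_homology_at[OF *(1)])
  show "local_homology m K \<sigma> \<omega> q \<cong> simplicial_homology \<omega> L q"
    unfolding local_homology_def simplicial_homology_def by (rule *(2))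
qed

lemma local_codiff_closed:
  assumes "f \<in> carrier (local_cochain m K \<sigma> \<omega> q)"
  shows "local_codiff m K \<sigma> \<omega> q f \<in> carrier (local_cochain m K \<sigma> \<omega> (q + 1))"
proof -
  have f: "f \<in> hom (local_chain m K \<sigma> \<omega> q) integer_group"
    using assms by (simp add: local_cochain_def carrier_dual_group)
  have "f (tensor_diff m (x + y)) = f (tensor_diff m x) + f (tensor_diff m y)"
    if "x \<in> carrier (local_chain m K \<sigma> \<omega> (q + 1))" "y \<in> carrier (local_chain m K \<sigma> \<omega> (q + 1))" for x y
    using f tensor_diff_closed[of x "q + 1"] tensor_diff_closed[of y "q + 1"] that
    unfolding local_chain_eq hom_def by (simp add: tensor_diff_def frag_extend_add)
  moreover have "x + y \<in> carrier (local_chain m K \<sigma> \<omega> (q + 1))"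
    if "x \<in> carrier (local_chain m K \<sigma> \<omega> (q + 1))" "y \<in> carrier (local_chain m K \<sigma> \<omega> (q + 1))" for x y
    using that keys_add[of x y] unfolding local_chain_def by auto
  ultimately have "local_codiff m K \<sigma> \<omega> q f \<in> hom (local_chain m K \<sigma> \<omega> (q + 1)) integer_group"
    by (intro homI) (simp_all add: local_codiff_def local_chain_def)
  then show ?thesis
    by (simp add: local_cochain_def carrier_dual_group local_codiff_def)
qed

lemma dual_coordinates_local_codiff:
  assumes "f \<in> carrier (local_cochain m K \<sigma> \<omega> q)"
  shows "dual_coordinates w (faces L (q + 1)) (local_codiff m K \<sigma> \<omega> q f) =
           coboundary L (dual_coordinates w (faces L q) f)"
proof
  let ?F = "free_Abelian_group (w ` faces L q)"
  have f: "f \<in> hom ?F integer_group"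
    using assms by (simp add: local_cochain_def carrier_dual_group local_chain_eq)
  fix \<rho>
  show "dual_coordinates w (faces L (q + 1)) (local_codiff m K \<sigma> \<omega> q f) \<rho> =
      coboundary L (dual_coordinates w (faces L q) f) \<rho>"
  proof (cases "\<rho> \<in> faces L (q + 1)")
    case True
    then have "\<rho> \<subseteq> \<omega>" and "\<rho> \<in> L"
      using faces_subset by (auto simp: faces_def)
    have face: "\<rho> - {k} \<in> faces L q" if "k \<in> \<rho>" for k
      using face_of_face[OF True that] by simp
    have f_sum: "f (\<Sum>k\<in>A. frag_cmul (face_sign k \<rho>) (frag_of (w (\<rho> - {k})))) =
        (\<Sum>k\<in>A. face_sign k \<rho> * f (frag_of (w (\<rho> - {k}))))" if "finite A" "A \<subseteq> \<rho>" for A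
      using that
    proof (induction A)
      case empty
      show ?case
        using integer_functional_zero[OF f] by simp
    next
      case (insert k A)
      have gen: "Poly_Mapping.keys (frag_of (w (\<rho> - {l}))) \<subseteq> w ` faces L q" if "l \<in> \<rho>" for l
        using face[OF that] by (simp add: keys_frag_of)
      have scaled: "Poly_Mapping.keys (frag_cmul (face_sign l \<rho>) (frag_of (w (\<rho> - {l})))) \<subseteq> w ` faces L q"
        if "l \<in> \<rho>" for l
        using gen[OF that] keys_cmul by blast
      have "(\<Sum>k\<in>A. frag_cmul (face_sign k \<rho>) (frag_of (w (\<rho> - {k})))) \<in> carrier ?F"
        using scaled insert.prems by (intro sum_closed_free_Abelian_group) auto
      moreover have "f (frag_cmul (face_sign k \<rho>) (frag_of (w (\<rho> - {k})))) =
          face_sign k \<rho> * f (frag_of (w (\<rho> - {k})))"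
        using integer_functional_minus[OF f gen[of k]] insert.prems
        by (cases "even (card (\<rho> \<inter> {..<k}))") (simp_all add: face_sign_def)
      ultimately show ?case
        using insert integer_functional_add[OF f scaled[of k]] by simp
    qed
    have "dual_coordinates w (faces L (q + 1)) (local_codiff m K \<sigma> \<omega> q f) \<rho> =
        f (tensor_diff m (frag_of (w \<rho>)))"
      using True by (simp add: dual_coordinates_def local_codiff_def local_chain_eq keys_frag_of)
    also have "\<dots> = (\<Sum>k\<in>\<rho>. face_sign k \<rho> * f (frag_of (w (\<rho> - {k}))))"
      using finite_subset[OF \<open>\<rho> \<subseteq> \<omega>\<close>] simplicial_complex_onD(1)[OF local_complex_complex]
      by (simp add: tensor_diff_local_tensor[OF \<sigma>\<omega> \<open>\<rho> \<subseteq> \<omega>\<close>] f_sum)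
    also have "\<dots> = coboundary L (dual_coordinates w (faces L q) f) \<rho>"
      using \<open>\<rho> \<in> L\<close> face by (simp add: coboundary_def dual_coordinates_def)
    finally show ?thesis .
  next
    case False
    have "dual_coordinates w (faces L q) f \<in> carrier (supported_functions (faces L q))"
      by (simp add: dual_coordinates_def carrier_supported_functions)
    from coboundary_closed[OF local_complex_complex this] False show ?thesis
      by (simp add: dual_coordinates_def carrier_supported_functions)
  qed
qed

lemma group_local_cohomology: "group (local_cohomology m K \<sigma> \<omega> q)"
  and local_cohomology_iso_simplicial: "local_cohomology m K \<sigma> \<omega> q \<cong> simplicial_cohomology L q"
proof -
  let ?C = "local_cochain m K \<sigma> \<omega>" and ?d = "local_codiff m K \<sigma> \<omega>"
  have comm: "comm_group (?C p)" for p
    unfolding local_cochain_def local_chain_def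
    by (rule comm_group_dual_group[OF group_free_Abelian_group])
  have iso: "dual_coordinates w (faces L p) \<in> iso (?C p) (supported_functions (faces L p))" for p
    unfolding local_cochain_def local_chain_eq by (rule dual_coordinates_iso[OF inj_on_faces])
  have closed: "?d p \<in> carrier (?C p) \<rightarrow> carrier (?C (p + 1))" for p
    using local_codiff_closed by blast
  have closed': "?d (q - 1) \<in> carrier (?C (q - 1)) \<rightarrow> carrier (?C q)"
    using closed[of "q - 1"] by simp
  have cochain_map': "dual_coordinates w (faces L q) (?d (q - 1) f) =
      coboundary L (dual_coordinates w (faces L (q - 1)) f)" if "f \<in> carrier (?C (q - 1))" for f
    using dual_coordinates_local_codiff[OF that] by simp
  note * = composable_homs_transfer[OF composable_coboundaries[OF local_complex_complex] comm comm comm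
      iso iso iso, OF closed' closed cochain_map' dual_coordinates_local_codiff]
  show "group (local_cohomology m K \<sigma> \<omega> q)"
    unfolding local_cohomology_def by (rule composable_homs.group_homology_at[OF *(1)])
  show "local_cohomology m K \<sigma> \<omega> q \<cong> simplicial_cohomology L q"
    unfolding local_cohomology_def simplicial_cohomology_def by (rule *(2))
qed

end

section \<open>Duality of local homology and cohomology\<close>

text \<open>
  For \<open>\<tau> \<subseteq> \<omega>\<close> the complement of \<open>\<tau> \<union> \<sigma>'\<close> in the whole vertex set is \<open>(\<omega> - \<tau>) \<union> \<sigma>\<close>, so both sides say
  that this set is not a simplex of \<open>K\<close>.
\<close>
lemma alexander_dual_local_complex:
  assumes "simplicial_complex_on {1..m} K" "(\<sigma>, \<omega>) \<in> index_pairs m"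
  shows "alexander_dual \<omega> (local_complex K \<sigma> \<omega>) =
           local_complex (alexander_dual {1..m} K) ({1..m} - (\<sigma> \<union> \<omega>)) \<omega>"
proof (rule Set.set_eqI)
  fix \<tau>
  show "\<tau> \<in> alexander_dual \<omega> (local_complex K \<sigma> \<omega>) \<longleftrightarrow>
      \<tau> \<in> local_complex (alexander_dual {1..m} K) ({1..m} - (\<sigma> \<union> \<omega>)) \<omega>"
  proof (cases "\<tau> \<subseteq> \<omega>")
    case True
    have compl: "{1..m} - (\<tau> \<union> ({1..m} - (\<sigma> \<union> \<omega>))) = (\<omega> - \<tau>) \<union> \<sigma>"
      and sub: "\<tau> \<union> ({1..m} - (\<sigma> \<union> \<omega>)) \<subseteq> {1..m}"
      using True assms(2) by (auto simp: index_pairs_def)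
    then show ?thesis
      using True sub unfolding alexander_dual_iff local_complex_iff[OF assms(1)]
        local_complex_iff[OF simplicial_complex_alexander_dual[OF assms(1)]] compl
      by blast
  qed (simp add: alexander_dual_iff local_complex_def)
qed

lemma indexed_complex_dual:
  assumes "indexed_complex m K \<sigma> \<omega>"
  shows "indexed_complex m (alexander_dual {1..m} K) ({1..m} - (\<sigma> \<union> \<omega>)) \<omega>"
  using assms simplicial_complex_alexander_dual
  unfolding indexed_complex_def index_pairs_def by blast

lemma local_duality_exists:
  assumes K: "simplicial_complex_on {1..m} K" and \<sigma>\<omega>: "(\<sigma>, \<omega>) \<in> index_pairs m" and "\<omega> \<noteq> {}"
  shows "local_homology m K \<sigma> \<omega> q \<cong>
           local_cohomology m (alexander_dual {1..m} K) ({1..m} - (\<sigma> \<union> \<omega>)) \<omega> (int (card \<omega>) - q - 1)"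
    (is "?H \<cong> local_cohomology m ?Kd ?\<sigma>' \<omega> ?r")
proof -
  interpret X: indexed_complex m K \<sigma> \<omega>
    using K \<sigma>\<omega> by (rule indexed_complex.intro)
  interpret Y: indexed_complex m ?Kd ?\<sigma>' \<omega>
    by (rule indexed_complex_dual[OF X.indexed_complex_axioms])
  note X.local_homology_iso_simplicial
  also note simplicial_alexander_duality[OF X.local_complex_complex assms(3)]
  also have "simplicial_cohomology (alexander_dual \<omega> (local_complex K \<sigma> \<omega>)) ?r \<cong>
      local_cohomology m ?Kd ?\<sigma>' \<omega> ?r"
    unfolding alexander_dual_local_complex[OF K \<sigma>\<omega>]
    by (rule group.iso_sym[OF Y.group_local_cohomology Y.local_cohomology_iso_simplicial])
  finally show ?thesis .
qed

text \<open>
  Any family of isomorphisms serves as \<open>\<gamma>\<close>: the dual family is then determined by the inverse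
  relation. The choice is made for all data at once, since \<open>\<gamma>\<degree>\<close> of \<open>K\<close> is the inverse of a value of
  \<open>\<gamma>\<close> at \<open>K\<degree>\<close>.
\<close>
definition local_duality ::
    "nat \<Rightarrow> nat set set \<Rightarrow> nat set \<Rightarrow> nat set \<Rightarrow> int
      \<Rightarrow> (tensor \<Rightarrow>\<^sub>0 int) set \<Rightarrow> ((tensor \<Rightarrow>\<^sub>0 int) \<Rightarrow> int) set" where
  "local_duality m K \<sigma> \<omega> q = (SOME h. h \<in> iso (local_homology m K \<sigma> \<omega> q)
     (local_cohomology m (alexander_dual {1..m} K) ({1..m} - (\<sigma> \<union> \<omega>)) \<omega> (int (card \<omega>) - q - 1)))"

definition local_duality_dual ::
    "nat \<Rightarrow> nat set set \<Rightarrow> nat set \<Rightarrow> nat set \<Rightarrow> int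
      \<Rightarrow> ((tensor \<Rightarrow>\<^sub>0 int) \<Rightarrow> int) set \<Rightarrow> (tensor \<Rightarrow>\<^sub>0 int) set" where
  "local_duality_dual m K \<sigma> \<omega> q =
     (let Kd = alexander_dual {1..m} K; \<sigma>' = {1..m} - (\<sigma> \<union> \<omega>); r = int (card \<omega>) - q - 1
      in inv_into (carrier (local_homology m Kd \<sigma>' \<omega> r)) (local_duality m Kd \<sigma>' \<omega> r))"

lemma local_duality_iso:
  assumes "simplicial_complex_on {1..m} K" "(\<sigma>, \<omega>) \<in> index_pairs m" "\<omega> \<noteq> {}"
  shows "local_duality m K \<sigma> \<omega> q \<in> iso (local_homology m K \<sigma> \<omega> q)
           (local_cohomology m (alexander_dual {1..m} K) ({1..m} - (\<sigma> \<union> \<omega>)) \<omega> (int (card \<omega>) - q - 1))"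
proof -
  have "\<exists>h. h \<in> iso (local_homology m K \<sigma> \<omega> q)
      (local_cohomology m (alexander_dual {1..m} K) ({1..m} - (\<sigma> \<union> \<omega>)) \<omega> (int (card \<omega>) - q - 1))"
    using local_duality_exists[OF assms] unfolding is_iso_def by blast
  then show ?thesis
    unfolding local_duality_def by (rule someI_ex)
qed

text \<open>
  Passing to the dual data is an involution on \<open>K\<close>, on \<open>\<sigma>\<close> and on the degree, so the isomorphism \<open>\<gamma>\<close> of the
  dual data ends in the cohomology of \<open>K\<close> itself.
\<close>
lemma local_duality_dual_iso:
  assumes K: "simplicial_complex_on {1..m} K" and \<sigma>\<omega>: "(\<sigma>, \<omega>) \<in> index_pairs m" and "\<omega> \<noteq> {}"
  shows "local_duality_dual m K \<sigma> \<omega> q \<in> iso (local_cohomology m K \<sigma> \<omega> q)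
           (local_homology m (alexander_dual {1..m} K) ({1..m} - (\<sigma> \<union> \<omega>)) \<omega> (int (card \<omega>) - q - 1))"
proof -
  let ?Kd = "alexander_dual {1..m} K" and ?\<sigma>' = "{1..m} - (\<sigma> \<union> \<omega>)" and ?r = "int (card \<omega>) - q - 1"
  interpret Y: indexed_complex m ?Kd ?\<sigma>' \<omega>
    using K \<sigma>\<omega> by (intro indexed_complex_dual indexed_complex.intro)
  have \<sigma>: "{1..m} - (?\<sigma>' \<union> \<omega>) = \<sigma>" and q: "int (card \<omega>) - ?r - 1 = q"
    using \<sigma>\<omega> by (auto simp: index_pairs_def)
  have "local_duality m ?Kd ?\<sigma>' \<omega> ?r \<in> iso (local_homology m ?Kd ?\<sigma>' \<omega> ?r) (local_cohomology m K \<sigma> \<omega> q)"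
    using local_duality_iso[OF Y.K Y.\<sigma>\<omega> assms(3), of ?r] unfolding alexander_dual_dual[OF K] \<sigma> q .
  then show ?thesis
    unfolding local_duality_dual_def Let_def
    by (rule group.iso_set_sym[OF Y.group_local_homology])
qed

theorem theorem5p4:
  fixes m :: nat
  shows "(\<forall>K \<sigma> \<omega>. simplicial_complex_on {1..m} K \<and> (\<sigma>, \<omega>) \<in> index_pairs m \<and> \<omega> \<noteq> {} \<longrightarrow>
           alexander_dual \<omega> (local_complex K \<sigma> \<omega>) =
             local_complex (alexander_dual {1..m} K) ({1..m} - (\<sigma> \<union> \<omega>)) \<omega>)
    \<and> (\<exists>(\<gamma> :: nat set set \<Rightarrow> nat set \<Rightarrow> nat set \<Rightarrow> int \<Rightarrow>
                 (tensor \<Rightarrow>\<^sub>0 int) set \<Rightarrow> ((tensor \<Rightarrow>\<^sub>0 int) \<Rightarrow> int) set)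
        (\<gamma>d :: nat set set \<Rightarrow> nat set \<Rightarrow> nat set \<Rightarrow> int \<Rightarrow>
                 ((tensor \<Rightarrow>\<^sub>0 int) \<Rightarrow> int) set \<Rightarrow> (tensor \<Rightarrow>\<^sub>0 int) set).
         \<forall>K \<sigma> \<omega>. simplicial_complex_on {1..m} K \<and> (\<sigma>, \<omega>) \<in> index_pairs m \<and> \<omega> \<noteq> {} \<longrightarrow>
           (let Kd = alexander_dual {1..m} K; \<sigma>' = {1..m} - (\<sigma> \<union> \<omega>) in
            \<forall>q :: int. let r = int (card \<omega>) - q - 1 in
              \<gamma> K \<sigma> \<omega> q \<in> iso (local_homology m K \<sigma> \<omega> q) (local_cohomology m Kd \<sigma>' \<omega> r) \<and>
              \<gamma>d K \<sigma> \<omega> q \<in> iso (local_cohomology m K \<sigma> \<omega> q) (local_homology m Kd \<sigma>' \<omega> r) \<and>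
              (\<forall>x \<in> carrier (local_cohomology m K \<sigma> \<omega> q).
                 \<gamma>d K \<sigma> \<omega> q x =
                   inv_into (carrier (local_homology m Kd \<sigma>' \<omega> r)) (\<gamma> Kd \<sigma>' \<omega> r) x)))"
proof (rule conjI)
  show "\<forall>K \<sigma> \<omega>. simplicial_complex_on {1..m} K \<and> (\<sigma>, \<omega>) \<in> index_pairs m \<and> \<omega> \<noteq> {} \<longrightarrow>
      alexander_dual \<omega> (local_complex K \<sigma> \<omega>) =
        local_complex (alexander_dual {1..m} K) ({1..m} - (\<sigma> \<union> \<omega>)) \<omega>"
    by (intro allI impI, elim conjE) (rule alexander_dual_local_complex)
  show "\<exists>\<gamma> \<gamma>d. \<forall>K \<sigma> \<omega>. simplicial_complex_on {1..m} K \<and> (\<sigma>, \<omega>) \<in> index_pairs m \<and> \<omega> \<noteq> {} \<longrightarrow>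
      (let Kd = alexander_dual {1..m} K; \<sigma>' = {1..m} - (\<sigma> \<union> \<omega>) in
        \<forall>q. let r = int (card \<omega>) - q - 1 in
          \<gamma> K \<sigma> \<omega> q \<in> iso (local_homology m K \<sigma> \<omega> q) (local_cohomology m Kd \<sigma>' \<omega> r) \<and>
          \<gamma>d K \<sigma> \<omega> q \<in> iso (local_cohomology m K \<sigma> \<omega> q) (local_homology m Kd \<sigma>' \<omega> r) \<and>
          (\<forall>x \<in> carrier (local_cohomology m K \<sigma> \<omega> q).
             \<gamma>d K \<sigma> \<omega> q x = inv_into (carrier (local_homology m Kd \<sigma>' \<omega> r)) (\<gamma> Kd \<sigma>' \<omega> r) x))"
    unfolding Let_def
  proof (intro exI[of _ "local_duality m"] exI[of _ "local_duality_dual m"] allI impI conjI ballI; elim conjE)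
    fix K \<sigma> \<omega> q x
    show "local_duality_dual m K \<sigma> \<omega> q x =
        inv_into (carrier (local_homology m (alexander_dual {1..m} K) ({1..m} - (\<sigma> \<union> \<omega>)) \<omega> (int (card \<omega>) - q - 1)))
          (local_duality m (alexander_dual {1..m} K) ({1..m} - (\<sigma> \<union> \<omega>)) \<omega> (int (card \<omega>) - q - 1)) x"
      by (simp only: local_duality_dual_def Let_def)
  qed (rule local_duality_iso local_duality_dual_iso, assumption+)+
qed

end
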